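(* Let $X\subseteq\mathbb{R}^d$ be convex and compact, let $f_1,\dots,f_M:X\to\mathbb{R}$ be closed convex functions, let $f=\frac1M\sum_{i=1}^M f_i$ and let $f^*$ be the minimum value of $f$ over $X$. Let $(j_k)_{k\ge 0}$ be a time-homogeneous, irreducible, aperiodic Markov chain on $[M]=\{1,\dots,M\}$ with transition matrix $P$ and uniform stationary distribution $(\frac1M,\dots,\frac1M)$. Let the stepsizes $\gamma_k>0$ satisfy $$\sum_k\gamma_k=+\infty,\qquad \sum_{k}\ln k\cdot\gamma_k^2<+\infty .$$ Let $(x^k)_{k\ge 0}$ be generated, from a deterministic and arbitrary initial point $x^0$, by $$x^{k+1}=\mathrm{Proj}_X\big(x^k-\gamma_k\hat\nabla f_{j_k}(x^k)\big),$$ where $\hat\nabla f_{j_k}(x^k)\in\partial f_{j_k}(x^k)$ is a subgradient. Put $\overline{x^k}:=\frac{\sum_{i=1}^k\gamma_i x^i}{\sum_{i=1}^k\gamma_i}$. Then: (1) $\lim_k \mathbb{E} f(x^k)=f^*$. (2) $\mathbb{E}\big(f(\overline{x^k})-f^*\big)=O\Big(\frac{\psi(P)}{\sum_{i=1}^k\gamma_i}\Big)$. (3) Therefore, if the stepsize is selected as $\gamma_k=\Theta(\frac1{k^q})$ with $\frac12<q<1$, then $\mathbb{E}(f(\overline{x^k})-f^* )=O\big(\frac{\psi(P)}{k^{1-q}}\big)$. Furthermore, consider the inexact iteration $$x^{k+1}=\mathrm{Proj}_X\big(x^k-\gamma_k(\hat\nabla f_{j_k}(x^k)+e^k)\big),$$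 where the noise sequence $(e^k)_{k\ge0}$ is arbitrary but obeys $\sum_{k=2}^{+\infty}\frac{\|e^k\|^2}{\ln k}<+\infty$. Then, for this iteration, (1) and (2) still hold; furthermore, if $\|e^k\|=O(\frac1{k^p})$ with $p>\frac12$ and $\gamma_k=\Theta(\frac1{k^q})$ with $\frac12<q<1$, the rate $\mathbb{E}(f(\overline{x^k})-f^* )=O\big(\frac{\psi(P)}{k^{1-q}}\big)$ also holds.
   Context: $\mathrm{Proj}_X$ is the Euclidean projection onto $X$, and $\partial f_i$ is the convex subdifferential of $f_i$. Let $\lambda_i(P)\in\mathbb{C}$ be the $i$th largest eigenvalue (in modulus) of the $M\times M$ matrix $P$, so $\lambda_1(P)=1$. Define $$\lambda(P):=\frac{\max\{|\lambda_2(P)|,|\lambda_M(P)|\}+1}{2}\in[0,1),\qquad \psi(P):=\max\Big\{1,\frac{1}{\ln(1/\lambda(P))}\Big\}.$$ $O(\cdot)$ and $\Theta(\cdot)$ are as $k\to\infty$.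
   Formalization: Each f_i is taken finite and convex on a neighbourhood of X (on X alone, unbounded boundary subgradients break the claim); subgradients and noise may depend only on j_0,…,j_k, and the conditions on ‖e^k‖ are imposed on a deterministic bound. *)

theory Defs
  imports
    "HOL-Probability.Probability"
    "HOL-Library.Landau_Symbols"
    "Jordan_Normal_Form.Char_Poly"
begin

text \<open>Markov chains on the finite state space \<open>{..<M}\<close>; the matrix entry \<open>P $$ (a, b)\<close> is the
  probability of moving from \<open>a\<close> to \<open>b\<close>.\<close>

definition stochastic_matrix :: "nat \<Rightarrow> real mat \<Rightarrow> bool" where
  "stochastic_matrix M P \<longleftrightarrow> P \<in> carrier_mat M M \<and>
     (\<forall>a<M. \<forall>b<M. 0 \<le> P $$ (a, b)) \<and> (\<forall>a<M. (\<Sum>b<M. P $$ (a, b)) = 1)"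

definition irreducible_matrix :: "nat \<Rightarrow> real mat \<Rightarrow> bool" where
  "irreducible_matrix M P \<longleftrightarrow> (\<forall>a<M. \<forall>b<M. \<exists>n. 0 < (P ^\<^sub>m n) $$ (a, b))"

definition aperiodic_matrix :: "nat \<Rightarrow> real mat \<Rightarrow> bool" where
  "aperiodic_matrix M P \<longleftrightarrow> (\<forall>a<M. Gcd {n. 0 < n \<and> 0 < (P ^\<^sub>m n) $$ (a, a)} = (1::nat))"

definition stationary_distribution :: "nat \<Rightarrow> real mat \<Rightarrow> (nat \<Rightarrow> real) \<Rightarrow> bool" where
  "stationary_distribution M P \<mu> \<longleftrightarrow> (\<forall>a<M. 0 \<le> \<mu> a) \<and> (\<Sum>a<M. \<mu> a) = 1 \<and>
     (\<forall>b<M. (\<Sum>a<M. \<mu> a * P $$ (a, b)) = \<mu> b)"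

text \<open>The law of the initial state \<open>j 0\<close> is unrestricted.\<close>

definition markov_chain ::
    "'w measure \<Rightarrow> nat \<Rightarrow> real mat \<Rightarrow> (nat \<Rightarrow> 'w \<Rightarrow> nat) \<Rightarrow> bool" where
  "markov_chain W M P j \<longleftrightarrow> prob_space W \<and> stochastic_matrix M P \<and>
     (\<forall>k. j k \<in> measurable W (count_space {..<M})) \<and>
     (\<forall>k s. (\<forall>l\<le>Suc k. s l < M) \<longrightarrow> \<P>(\<omega> in W. \<forall>l\<le>k. j l \<omega> = s l) \<noteq> 0 \<longrightarrow>
        \<P>(\<omega> in W. j (Suc k) \<omega> = s (Suc k) \<bar> \<forall>l\<le>k. j l \<omega> = s l) = P $$ (s k, s (Suc k)))"

text \<open>\<open>eig_modulus P i\<close> is the modulus of the \<open>i\<close>th largest eigenvalue (\<open>i = 1, \<dots>, M\<close>), where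
  eigenvalues are counted with algebraic multiplicity. It has no meaning for \<open>i > M\<close>, hence
  \<open>mixing_rate P\<close> presupposes \<open>M \<ge> 2\<close>; in all cases \<open>mixing_psi P \<ge> 1\<close>.\<close>

definition eig_modulus :: "real mat \<Rightarrow> nat \<Rightarrow> real" where
  "eig_modulus P i =
     rev (sorted_list_of_multiset
       (image_mset cmod (proots (char_poly (map_mat complex_of_real P))))) ! (i - 1)"

definition mixing_rate :: "real mat \<Rightarrow> real" where
  "mixing_rate P = (max (eig_modulus P 2) (eig_modulus P (dim_row P)) + 1) / 2"

definition mixing_psi :: "real mat \<Rightarrow> real" where
  "mixing_psi P = max 1 (1 / ln (1 / mixing_rate P))"

text \<open>A convex function with effective domain \<open>D\<close> is represented by \<open>f\<close> restricted to \<open>D\<close> (value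
  \<open>+\<infinity>\<close> elsewhere). So its epigraph is \<open>epigraph D f\<close>, and testing the subgradient inequality on
  \<open>D\<close> is the same as testing it on the whole space.\<close>

definition closed_convex_on :: "'a::euclidean_space set \<Rightarrow> ('a \<Rightarrow> real) \<Rightarrow> bool" where
  "closed_convex_on D f \<longleftrightarrow> convex_on D f \<and> closed (epigraph D f)"

definition subdifferential ::
    "'a::euclidean_space set \<Rightarrow> ('a \<Rightarrow> real) \<Rightarrow> 'a \<Rightarrow> 'a set" where
  "subdifferential D f x = {g. x \<in> D \<and> (\<forall>y\<in>D. f x + g \<bullet> (y - x) \<le> f y)}"

text \<open>\<open>Y k\<close> is a function of \<open>j 0, \<dots>, j k\<close>. As these take finitely many values, this is
  measurability of \<open>Y k\<close> with respect to the sigma-algebra they generate.\<close>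

definition chain_adapted ::
    "'w measure \<Rightarrow> (nat \<Rightarrow> 'w \<Rightarrow> nat) \<Rightarrow> (nat \<Rightarrow> 'w \<Rightarrow> 'b) \<Rightarrow> bool" where
  "chain_adapted W j Y \<longleftrightarrow>
     (\<forall>k. \<forall>\<omega>\<in>space W. \<forall>\<omega>'\<in>space W. (\<forall>l\<le>k. j l \<omega> = j l \<omega>') \<longrightarrow> Y k \<omega> = Y k \<omega>')"

text \<open>The subgradients \<open>g k\<close> may be chosen in any way that does not anticipate the chain. This
  includes a fixed selection: as \<open>x k\<close> depends on \<open>j 0, \<dots>, j (k - 1)\<close> only, a subgradient that is
  a function of \<open>j k \<omega>\<close> and \<open>x k \<omega>\<close> is adapted.\<close>

definition mcgd_iteration ::
    "'w measure \<Rightarrow> (nat \<Rightarrow> 'w \<Rightarrow> nat) \<Rightarrow> 'a::euclidean_space set \<Rightarrow> (nat \<Rightarrow> 'a set) \<Rightarrow>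
     (nat \<Rightarrow> 'a \<Rightarrow> real) \<Rightarrow> (nat \<Rightarrow> real) \<Rightarrow> (nat \<Rightarrow> 'w \<Rightarrow> 'a) \<Rightarrow> 'a \<Rightarrow> (nat \<Rightarrow> 'w \<Rightarrow> 'a) \<Rightarrow> bool" where
  "mcgd_iteration W j X D f \<gamma> e x0 x \<longleftrightarrow>
     (\<forall>\<omega>\<in>space W. x 0 \<omega> = x0) \<and>
     (\<exists>g. chain_adapted W j g \<and>
        (\<forall>k. \<forall>\<omega>\<in>space W.
           g k \<omega> \<in> subdifferential (D (j k \<omega>)) (f (j k \<omega>)) (x k \<omega>) \<and>
           x (Suc k) \<omega> = closest_point X (x k \<omega> - \<gamma> k *\<^sub>R (g k \<omega> + e k \<omega>))))"

definition mean_fun :: "nat \<Rightarrow> (nat \<Rightarrow> 'a \<Rightarrow> real) \<Rightarrow> 'a \<Rightarrow> real" where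
  "mean_fun M f y = (\<Sum>i<M. f i y) / real M"

definition weighted_avg :: "(nat \<Rightarrow> real) \<Rightarrow> (nat \<Rightarrow> 'w \<Rightarrow> 'a::real_vector) \<Rightarrow> nat \<Rightarrow> 'w \<Rightarrow> 'a" where
  "weighted_avg \<gamma> x k \<omega> = (\<Sum>i=1..k. \<gamma> i *\<^sub>R x i \<omega>) /\<^sub>R (\<Sum>i=1..k. \<gamma> i)"

end

theory Submission
  imports Defs
begin

text \<open>Let \<open>x\<^sup>*\<close> minimise \<open>f\<close> over \<open>X\<close>. The usual subgradient estimate bounds the sum of
  \<open>\<gamma>\<^sub>k E(f\<^bsub>j_k\<^esub>(x\<^sup>k) - f\<^bsub>j_k\<^esub>(x\<^sup>*))\<close>; it remains to control the bias that arises when \<open>f\<^bsub>j_k\<^esub>\<close> is replaced by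
  the mean \<open>f\<close>. Both \<open>x\<^bsup>n+1\<^esup>\<close> and \<open>x\<^sup>n\<close> are functions of \<open>j\<^sub>0, \<dots>, j\<^sub>n\<close>, so conditioning on these shows
  that going from \<open>x\<^sup>n\<close> to \<open>x\<^bsup>n+1\<^esup>\<close> changes the bias at time \<open>k\<close> by \<open>O(\<rho>\<^bsup>k-n\<^esup> |x\<^bsup>n+1\<^esup> - x\<^sup>n|)\<close>, where \<open>\<rho> < 1\<close> is the
  geometric mixing rate of the chain. Thus the bias is at most the convolution of a geometric sequence
  with the square summable step lengths, which is square summable itself, and
  \<open>\<Sum> \<gamma>\<^sub>k E(f(x\<^sup>k) - f(x\<^sup>*))\<close> is finite. Jensen's inequality turns this into the rate for the averages. As
  consecutive gaps differ by \<open>O(\<gamma>\<^sub>k)\<close> plus a summable term, it also makes the gaps converge to 0.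

  Since \<open>P\<close> is fixed, the factor \<open>mixing_psi P\<close> is a positive constant and plays no role in the bounds;
  \<open>\<rho>\<close> comes from a Doeblin contraction, not from the spectrum of \<open>P\<close>.\<close>

section \<open>Real sequences\<close>

text \<open>The least positive difference \<open>d\<close> between two members of \<open>T\<close>
  divides every member of \<open>S\<close>, so \<open>d = 1\<close>. With \<open>n\<close> and
  \<open>n + 1\<close> both in \<open>T\<close>, every number beyond \<open>n * n\<close> is a
  nonnegative combination of these two. Applied to return times, this turns aperiodicity into
  positivity of all large powers.\<close>

lemma eventually_mem_additive_Gcd_1:
  fixes S :: "nat set"
  assumes add: "\<And>a b. a \<in> S \<Longrightarrow> b \<in> S \<Longrightarrow> a + b \<in> S" and gcd: "Gcd S = 1"
  shows "eventually (\<lambda>n. n \<in> S) sequentially"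
proof -
  define T where "T = insert 0 S"
  have T_add: "a + b \<in> T" if "a \<in> T" "b \<in> T" for a b
    using that add by (auto simp: T_def)
  have T_mult: "q * a \<in> T" if "a \<in> T" for q a
    by (induction q) (use that T_add in \<open>auto simp: T_def\<close>)
  have "\<exists>s\<in>S. s \<noteq> 0"
  proof (rule ccontr)
    assume "\<not> ?thesis"
    then have "0 dvd Gcd S" by (intro Gcd_greatest) auto
    with gcd show False by simp
  qed
  then obtain s where s: "s \<in> S" "s \<noteq> 0" by blast
  define gaps where "gaps d \<longleftrightarrow> 0 < d \<and> (\<exists>n\<in>T. n + d \<in> T)" for d
  have "gaps s" using s by (auto simp: gaps_def T_def)
  define d where "d = (LEAST d. gaps d)"
  have "gaps d" unfolding d_def by (rule LeastI) fact
  then obtain n where n: "n \<in> T" "n + d \<in> T" "0 < d" by (auto simp: gaps_def)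
  have least: "d \<le> d'" if "gaps d'" for d'
    unfolding d_def using that by (rule Least_le)
  have "d dvd m" if "m \<in> S" for m
  proof (rule ccontr)
    assume "\<not> d dvd m"
    then have r: "0 < m mod d" by (simp add: mod_greater_zero_iff_not_dvd)
    define q where "q = m div d"
    have m: "m = q * d + m mod d" by (simp add: q_def)
    \<comment> \<open>These two members of \<open>T\<close> differ by \<open>d - m mod d\<close>,
      which is positive and smaller than \<open>d\<close>, against minimality.\<close>
    have "m + (q + 1) * n \<in> T" "(q + 1) * (n + d) \<in> T"
      using T_add[OF _ T_mult[OF n(1)]] T_mult[OF n(2)] that by (blast intro: T_def[THEN equalityD2, THEN subsetD])+
    moreover have "(q + 1) * (n + d) = m + (q + 1) * n + (d - m mod d)"
      using m mod_less_divisor[OF n(3), of m] by (simp add: algebra_simps)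
    ultimately have "gaps (d - m mod d)"
      using mod_less_divisor[OF n(3), of m] by (auto simp: gaps_def)
    then have "d \<le> d - m mod d" by (rule least)
    with r n(3) show False by linarith
  qed
  then have "d dvd Gcd S" by (rule Gcd_greatest)
  with gcd n have consec: "n \<in> T" "n + 1 \<in> T" by auto
  have "m \<in> S" if "m > n * n" for m
  proof -
    have "m \<in> T"
    proof (cases "n = 0")
      case True
      with T_mult[OF consec(2), of m] show ?thesis by simp
    next
      case False
      define k where "k = m - n * n"
      have lt: "k mod n < n" using False by simp
      \<comment> \<open>The part \<open>n * n\<close> of \<open>m\<close> supplies \<open>n\<close>
        copies of \<open>n\<close>; replacing \<open>k mod n\<close> of them by \<open>n + 1\<close>
        produces the remainder of \<open>k\<close>.\<close>
      have "m = (n - k mod n + k div n) * n + (k mod n) * (n + 1)"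
      proof -
        have "(n - k mod n) * n + (k mod n) * n = n * n"
          using lt by (simp flip: add_mult_distrib)
        moreover have "k = k div n * n + k mod n" by simp
        moreover have "m = n * n + k" using that by (simp add: k_def)
        ultimately show ?thesis by (simp add: add_mult_distrib)
      qed
      with T_add[OF T_mult[OF consec(1)] T_mult[OF consec(2)]] show ?thesis by metis
    qed
    with that show ?thesis by (auto simp: T_def)
  qed
  then show ?thesis by (auto simp: eventually_at_top_dense)
qed

text \<open>A factor \<theta> per period of length \<open>N\<close> is a factor
  \<open>root N \<theta>\<close> per step. Dividing by \<theta> pays for an incomplete period: there
  \<open>root N \<theta> ^ m\<close> is still at least \<theta>.\<close>

lemma geometric_bound_of_periodic_contraction:
  fixes v :: "nat \<Rightarrow> real"
  assumes decr: "\<And>m. v m \<le> v 0" and per: "\<And>m. v (m + N) \<le> \<theta> * v m"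
    and \<theta>: "0 < \<theta>" "\<theta> < 1" and N: "0 < N" and v0: "0 \<le> v 0"
  shows "v m \<le> v 0 / \<theta> * root N \<theta> ^ m"
proof (induction m rule: less_induct)
  case (less m)
  have \<rho>: "0 < root N \<theta>" "root N \<theta> \<le> 1" "root N \<theta> ^ N = \<theta>"
    using \<theta> N by (auto simp: real_root_le_1_iff)
  show ?case
  proof (cases "m < N")
    case True
    have "\<theta> \<le> root N \<theta> ^ m"
      using power_decreasing[of m N "root N \<theta>"] True \<rho> by simp
    then have "v 0 * 1 \<le> v 0 * (root N \<theta> ^ m / \<theta>)"
      using v0 \<theta> by (intro mult_left_mono) auto
    with decr[of m] show ?thesis by simp
  next
    case False
    then have m: "m = (m - N) + N" by simp
    have "v m \<le> \<theta> * v (m - N)" using per[of "m - N"] m by simp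
    also have "\<dots> \<le> \<theta> * (v 0 / \<theta> * root N \<theta> ^ (m - N))"
      using \<theta> N False by (intro mult_left_mono less.IH) auto
    also have "\<dots> = v 0 / \<theta> * (root N \<theta> ^ (m - N) * root N \<theta> ^ N)"
      using \<rho> by simp
    also have "\<dots> = v 0 / \<theta> * root N \<theta> ^ m"
      using m by (metis power_add)
    finally show ?thesis .
  qed
qed

text \<open>Summing the recursion bounds a partial sum by \<rho> times itself plus a constant, and
  \<rho> < 1 lets that term be absorbed.\<close>

lemma summable_contraction:
  fixes a b :: "nat \<Rightarrow> real"
  assumes a: "\<And>k. 0 \<le> a k" and b: "summable b" "\<And>k. 0 \<le> b k" and \<rho>: "0 \<le> \<rho>" "\<rho> < 1"
    and rec: "\<And>k. a (Suc k) \<le> \<rho> * a k + b k"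
  shows "summable a"
proof (rule summableI_nonneg_bounded)
  fix n
  have "(\<Sum>i<n. a i) \<le> a 0 + (\<Sum>i<n. a (Suc i))"
    using sum.lessThan_Suc_shift[of a n] a[of n] by simp
  also have "(\<Sum>i<n. a (Suc i)) \<le> (\<Sum>i<n. \<rho> * a i + b i)" by (intro sum_mono rec)
  also have "\<dots> = \<rho> * (\<Sum>i<n. a i) + (\<Sum>i<n. b i)" by (simp add: sum.distrib sum_distrib_left)
  also have "(\<Sum>i<n. b i) \<le> suminf b" using b by (intro sum_le_suminf) auto
  finally have "(1 - \<rho>) * (\<Sum>i<n. a i) \<le> a 0 + suminf b" by (simp add: algebra_simps)
  with \<rho> show "(\<Sum>i<n. a i) \<le> (a 0 + suminf b) / (1 - \<rho>)"
    by (simp add: field_simps)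
qed (use a in auto)

text \<open>Up to its initial value, \<open>w\<close> is the convolution of \<open>s\<close> with a
  geometric sequence. Its squares satisfy a contraction recursion driven by the squares of
  \<open>s\<close>, hence are summable, and the product with \<gamma> is dominated by the sum of the
  squares.\<close>

lemma summable_mult_geometric_filter:
  fixes \<gamma> s w :: "nat \<Rightarrow> real"
  assumes \<gamma>: "summable (\<lambda>k. (\<gamma> k)\<^sup>2)" and s: "summable (\<lambda>k. (s k)\<^sup>2)" and \<rho>: "0 < \<rho>" "\<rho> < 1"
    and rec: "\<And>k. w (Suc k) = \<rho> * (w k + s k)"
  shows "summable (\<lambda>k. \<gamma> k * w k)"
proof -
  have "summable (\<lambda>k. (w k)\<^sup>2)"
  proof (rule summable_contraction)
    show "summable (\<lambda>k. \<rho>\<^sup>2 / (1 - \<rho>) * (s k)\<^sup>2)" using s by (rule summable_mult)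
    fix k
    \<comment> \<open>Young's inequality with weights chosen so that the coefficient of
      \<open>(w k)^2\<close> becomes \<rho> < 1; the slack is a multiple of a perfect
      square.\<close>
    have "\<rho> * (w k)\<^sup>2 + \<rho>\<^sup>2 / (1 - \<rho>) * (s k)\<^sup>2 - (\<rho> * (w k + s k))\<^sup>2
        = \<rho> / (1 - \<rho>) * ((1 - \<rho>) * w k - \<rho> * s k)\<^sup>2"
      using \<rho> by (simp add: divide_simps power2_eq_square) (simp add: algebra_simps)
    also have "\<dots> \<ge> 0" using \<rho> by simp
    finally show "(w (Suc k))\<^sup>2 \<le> \<rho> * (w k)\<^sup>2 + \<rho>\<^sup>2 / (1 - \<rho>) * (s k)\<^sup>2"
      by (simp add: rec)
  qed (use \<rho> in auto)
  with \<gamma> have "summable (\<lambda>k. (\<gamma> k)\<^sup>2 + (w k)\<^sup>2)" by (rule summable_add)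
  then show ?thesis
  proof (rule summable_comparison_test')
    fix k
    show "norm (\<gamma> k * w k) \<le> (\<gamma> k)\<^sup>2 + (w k)\<^sup>2"
      using sum_squares_bound[of "\<bar>\<gamma> k\<bar>" "\<bar>w k\<bar>"] mult_nonneg_nonneg[of "\<bar>\<gamma> k\<bar>" "\<bar>w k\<bar>"]
      unfolding real_norm_def abs_mult power2_abs by linarith
  qed
qed

text \<open>Divergence of the sum of \<gamma> forces \<open>a\<close> below any level \<delta> at
  arbitrarily late times. Afterwards \<open>a\<close> can rise only slightly: while it is at least
  \<delta>, each increase \<open>C * \<gamma> k\<close> is at most \<open>C / \<delta>\<close> times
  the summable term \<open>\<gamma> k * a k\<close>.\<close>

lemma tendsto_0_of_weighted_summable:
  fixes a \<gamma> s :: "nat \<Rightarrow> real"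
  assumes a: "\<And>k. 0 \<le> a k" and \<gamma>: "\<And>k. 0 \<le> \<gamma> k" "\<gamma> \<longlonglongrightarrow> 0" "\<not> summable \<gamma>"
    and wsum: "summable (\<lambda>k. \<gamma> k * a k)" and s: "\<And>k. 0 \<le> s k" "summable s" and C: "0 \<le> C"
    and step: "\<And>k. a (Suc k) \<le> a k + C * \<gamma> k + s k"
  shows "a \<longlonglongrightarrow> 0"
proof (rule LIMSEQ_I)
  fix r :: real assume r: "0 < r"
  define \<delta> where "\<delta> = r / 4"
  have \<delta>: "0 < \<delta>" using r by (simp add: \<delta>_def)
  \<comment> \<open>\<open>c k\<close> dominates the increase of \<open>a\<close> at every
    \<open>k\<close> with \<open>a k\<close> at least \<delta>, and its tails are small.\<close>
  define c where "c k = C / \<delta> * (\<gamma> k * a k) + s k" for k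
  have c: "summable c" "\<And>k. 0 \<le> c k"
    unfolding c_def using wsum s a \<gamma> C \<delta> by (auto intro!: summable_add summable_mult)
  have "\<forall>\<^sub>F K in sequentially. \<bar>\<Sum>i. c (i + K)\<bar> < \<delta>"
    using suminf_exist_split[OF \<delta> c(1)] by (auto simp: eventually_sequentially)
  moreover have "\<forall>\<^sub>F K in sequentially. C * \<gamma> K < \<delta>"
    using tendsto_mult_right_zero[OF \<gamma>(2)] \<delta> by (rule order_tendstoD)
  then have "\<forall>\<^sub>F K in sequentially. \<forall>k\<ge>K. C * \<gamma> k < \<delta>"
    by (rule eventually_all_ge_at_top)
  ultimately have "\<forall>\<^sub>F K in sequentially. \<bar>\<Sum>i. c (i + K)\<bar> < \<delta> \<and> (\<forall>k\<ge>K. C * \<gamma> k < \<delta>)"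
    by (rule eventually_conj)
  then obtain K0 where K0: "\<And>K. K \<ge> K0 \<Longrightarrow> \<bar>\<Sum>i. c (i + K)\<bar> < \<delta>"
      "\<And>k. k \<ge> K0 \<Longrightarrow> C * \<gamma> k < \<delta>"
    by (auto simp: eventually_sequentially)
  have "\<exists>K\<ge>K0. a K < \<delta>"
  proof (rule ccontr)
    assume "\<not> ?thesis"
    then have "\<gamma> k * \<delta> \<le> \<gamma> k * a k" if "k \<ge> K0" for k
      using that \<gamma>(1) by (intro mult_left_mono) (auto simp: not_less)
    then have "\<And>k. k \<ge> K0 \<Longrightarrow> norm (\<gamma> k) \<le> 1 / \<delta> * (\<gamma> k * a k)"
      using \<delta> \<gamma>(1) by (simp add: pos_le_divide_eq)
    then have "summable \<gamma>"
      by (rule summable_comparison_test'[OF summable_mult[OF wsum]])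
    with \<gamma> show False by simp
  qed
  then obtain K where K: "K \<ge> K0" "a K < \<delta>" by blast
  \<comment> \<open>From below \<delta>, one step leads to at most 2\<delta> plus \<open>s\<close>,
    whatever happened before; from above \<delta>, the induction hypothesis is extended by one term
    of \<open>c\<close>.\<close>
  have bound: "a (K + n) \<le> 2 * \<delta> + (\<Sum>i<n. c (i + K))" for n
  proof (induction n)
    case 0
    with K \<delta> show ?case by simp
  next
    case (Suc n)
    have Cg: "C * \<gamma> (K + n) < \<delta>" using K0(2) K(1) by simp
    show ?case
    proof (cases "a (K + n) < \<delta>")
      case True
      have "a (K + Suc n) \<le> 2 * \<delta> + s (K + n)" using step[of "K + n"] True Cg by simp
      also have "s (K + n) \<le> c (n + K)"
        using a \<gamma> C \<delta> by (simp add: c_def add.commute)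
      also have "c (n + K) \<le> (\<Sum>i<Suc n. c (i + K))"
        using c(2) by (simp add: sum_nonneg)
      finally show ?thesis by simp
    next
      case False
      then have "C * \<gamma> (K + n) * \<delta> \<le> C * \<gamma> (K + n) * a (K + n)"
        using C \<gamma> by (intro mult_left_mono) auto
      then have "C * \<gamma> (K + n) \<le> C / \<delta> * (\<gamma> (K + n) * a (K + n))"
        using \<delta> by (simp add: field_simps)
      with step[of "K + n"] Suc show ?thesis by (simp add: c_def add.commute)
    qed
  qed
  have "a k < r" if "k \<ge> K" for k
  proof -
    have "(\<Sum>i<k - K. c (i + K)) \<le> (\<Sum>i. c (i + K))"
      using c by (intro sum_le_suminf) (auto simp: summable_iff_shift)
    also have "\<dots> < \<delta>" using K0(1)[OF K(1)] by simp
    finally show ?thesis using bound[of "k - K"] that \<delta> by (simp add: \<delta>_def)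
  qed
  then show "\<exists>K. \<forall>k\<ge>K. norm (a k - 0) < r" using a by auto
qed

lemma summable_telescope_bound:
  fixes b v c :: "nat \<Rightarrow> real"
  assumes b: "\<And>k. 0 \<le> b k" and v: "\<And>k. 0 \<le> v k" and c: "summable c" "\<And>k. 0 \<le> c k"
    and le: "\<And>k. b k \<le> v k - v (Suc k) + c k"
  shows "summable b"
proof (rule summableI_nonneg_bounded[OF b])
  fix n
  have "(\<Sum>k<n. b k) \<le> (\<Sum>k<n. v k - v (Suc k)) + (\<Sum>k<n. c k)"
    by (subst sum.distrib[symmetric]) (intro sum_mono le)
  also have "(\<Sum>k<n. v k - v (Suc k)) = v 0 - v n" by (rule sum_lessThan_telescope')
  also have "(\<Sum>k<n. c k) \<le> suminf c" using c by (intro sum_le_suminf) auto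
  finally show "(\<Sum>k<n. b k) \<le> v 0 + suminf c" using v[of n] by simp
qed

section \<open>Consequences of the stepsize and noise conditions\<close>

lemma summable_sq_of_ln_weighted:
  fixes \<gamma> :: "nat \<Rightarrow> real"
  assumes "summable (\<lambda>k. ln (real k) * (\<gamma> k)\<^sup>2)"
  shows "summable (\<lambda>k. (\<gamma> k)\<^sup>2)"
  using assms
proof (rule summable_comparison_test'[where N = 3])
  fix k :: nat assume "k \<ge> 3"
  \<comment> \<open>The threshold 3 comes from \<open>exp 1 \<le> 3\<close>.\<close>
  then have "1 \<le> ln (real k)" using exp_le by (subst ln_ge_iff) auto
  then have "1 * (\<gamma> k)\<^sup>2 \<le> ln (real k) * (\<gamma> k)\<^sup>2" by (rule mult_right_mono) simp
  then show "norm ((\<gamma> k)\<^sup>2) \<le> ln (real k) * (\<gamma> k)\<^sup>2" by simp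
qed

text \<open>The logarithmic weights of the two conditions are reciprocal, so they cancel in the
  product when \<gamma> is scaled by the root of the logarithm and \<epsilon> by its inverse. The
  shift by 2 keeps the logarithm positive.\<close>

lemma summable_mult_of_ln_weighted:
  fixes \<gamma> \<epsilon> :: "nat \<Rightarrow> real"
  assumes \<gamma>: "summable (\<lambda>k. ln (real k) * (\<gamma> k)\<^sup>2)"
    and \<epsilon>: "summable (\<lambda>k. (\<epsilon> (k + 2))\<^sup>2 / ln (real (k + 2)))"
  shows "summable (\<lambda>k. \<gamma> k * \<epsilon> k)"
proof -
  have "summable (\<lambda>k. ln (real (k + 2)) * (\<gamma> (k + 2))\<^sup>2 + (\<epsilon> (k + 2))\<^sup>2 / ln (real (k + 2)))"
    using summable_ignore_initial_segment[OF \<gamma>, of 2] \<epsilon> by (rule summable_add)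
  then have "summable (\<lambda>k. \<gamma> (k + 2) * \<epsilon> (k + 2))"
  proof (rule summable_comparison_test')
    fix k
    define l where "l = ln (real (k + 2))"
    have l: "0 < l" by (simp add: l_def)
    define u v where "u = sqrt l * \<bar>\<gamma> (k + 2)\<bar>" and "v = \<bar>\<epsilon> (k + 2)\<bar> / sqrt l"
    have "u * v = norm (\<gamma> (k + 2) * \<epsilon> (k + 2))" using l by (simp add: u_def v_def abs_mult)
    moreover have "u\<^sup>2 = l * (\<gamma> (k + 2))\<^sup>2" "v\<^sup>2 = (\<epsilon> (k + 2))\<^sup>2 / l"
      using l by (simp_all add: u_def v_def power_mult_distrib power_divide)
    moreover have "u * v \<le> u\<^sup>2 + v\<^sup>2"
      using sum_squares_bound[of u v] zero_le_power2[of u] zero_le_power2[of v] by linarith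
    ultimately show "norm (\<gamma> (k + 2) * \<epsilon> (k + 2))
        \<le> ln (real (k + 2)) * (\<gamma> (k + 2))\<^sup>2 + (\<epsilon> (k + 2))\<^sup>2 / ln (real (k + 2))"
      unfolding l_def[symmetric] by simp
  qed
  then show ?thesis by (simp only: summable_iff_shift[of "\<lambda>k. \<gamma> k * \<epsilon> k" 2])
qed

text \<open>The squares are of order \<open>k powr (- 2 * p)\<close> with \<open>2 * p > 1\<close>,
  and division by a logarithm that is at least 1 preserves the bound.\<close>

lemma summable_sq_div_ln_of_powr:
  fixes \<epsilon> :: "nat \<Rightarrow> real"
  assumes p: "1 / 2 < p" and \<epsilon>: "\<epsilon> \<in> O(\<lambda>k. 1 / real k powr p)"
  shows "summable (\<lambda>k. (\<epsilon> (k + 2))\<^sup>2 / ln (real (k + 2)))"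
proof -
  obtain c where c: "\<forall>\<^sub>F k in sequentially. norm (\<epsilon> k) \<le> c * norm (1 / real k powr p)"
    using \<epsilon> by (rule landau_o.bigE)
  have "summable (\<lambda>k. c\<^sup>2 * real k powr (- 2 * p))"
    using p by (intro summable_mult) (simp add: summable_real_powr_iff)
  moreover have "\<forall>\<^sub>F k in sequentially. norm ((\<epsilon> k)\<^sup>2 / ln (real k)) \<le> c\<^sup>2 * real k powr (- 2 * p)"
    using c eventually_ge_at_top[of 3]
  proof eventually_elim
    case (elim k)
    have ln: "1 \<le> ln (real k)" using elim exp_le by (subst ln_ge_iff) auto
    have "(norm (\<epsilon> k))\<^sup>2 \<le> (c * norm (1 / real k powr p))\<^sup>2"
      using elim by (intro power_mono) auto
    also have "\<dots> = c\<^sup>2 * real k powr (- 2 * p)"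
      by (simp add: power_mult_distrib power_divide powr_minus_divide flip: powr_power)
        (simp add: power2_eq_square flip: powr_add)
    finally have "(\<epsilon> k)\<^sup>2 \<le> c\<^sup>2 * real k powr (- 2 * p)" by simp
    moreover have "(\<epsilon> k)\<^sup>2 / ln (real k) \<le> (\<epsilon> k)\<^sup>2 / 1"
      using ln by (intro divide_left_mono) auto
    ultimately show ?case using ln by simp
  qed
  ultimately have "summable (\<lambda>k. (\<epsilon> k)\<^sup>2 / ln (real k))"
    by (rule summable_comparison_test_ev[rotated])
  then show ?thesis by (rule summable_ignore_initial_segment)
qed

text \<open>For \<open>k > 2 * K\<close>, at least half of the indices up to \<open>k\<close> lie
  beyond \<open>K\<close>, and each of them contributes at least
  \<open>c / real k powr q\<close>.\<close>

lemma powr_bigo_sum: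
  fixes \<gamma> :: "nat \<Rightarrow> real"
  assumes \<gamma>: "\<And>k. 0 \<le> \<gamma> k" "\<gamma> \<in> \<Omega>(\<lambda>k. 1 / real k powr q)" and q: "0 \<le> q"
  shows "(\<lambda>k. real k powr (1 - q)) \<in> O(\<lambda>k. \<Sum>i=1..k. \<gamma> i)"
proof -
  obtain c where c: "0 < c" "\<forall>\<^sub>F k in sequentially. norm (\<gamma> k) \<ge> c * norm (1 / real k powr q)"
    using \<gamma>(2) by (rule landau_omega.bigE)
  then obtain K where K: "\<And>k. k \<ge> K \<Longrightarrow> c / real k powr q \<le> \<gamma> k"
    using \<gamma>(1) by (auto simp: eventually_sequentially)
  show ?thesis
  proof (rule landau_o.bigI[of "2 / c"])
    show "\<forall>\<^sub>F k in sequentially. norm (real k powr (1 - q)) \<le> 2 / c * norm (\<Sum>i=1..k. \<gamma> i)"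
      using eventually_ge_at_top[of "2 * K + 1"]
    proof eventually_elim
      case (elim k)
      have "c / 2 * real k powr (1 - q) = real k / 2 * (c / real k powr q)"
        using elim by (simp add: powr_diff)
      also have "\<dots> \<le> real (k - K) * (c / real k powr q)"
        using elim c by (intro mult_right_mono) auto
      also have "\<dots> = (\<Sum>i\<in>{K+1..k}. c / real k powr q)" by simp
      also have "\<dots> \<le> (\<Sum>i\<in>{K+1..k}. \<gamma> i)"
      proof (rule sum_mono)
        fix i assume i: "i \<in> {K+1..k}"
        then have "c / real k powr q \<le> c / real i powr q"
          using c q by (intro divide_left_mono powr_mono2) auto
        also have "\<dots> \<le> \<gamma> i" using i by (intro K) auto
        finally show "c / real k powr q \<le> \<gamma> i" .
      qed
      also have "\<dots> \<le> (\<Sum>i=1..k. \<gamma> i)" using \<gamma>(1) by (intro sum_mono2) auto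
      finally have "real k powr (1 - q) \<le> 2 / c * (\<Sum>i=1..k. \<gamma> i)"
        using c by (simp add: field_simps)
      then show ?case using \<gamma>(1) by (simp add: sum_nonneg)
    qed
  qed (use c in simp)
qed

section \<open>Mixing of stochastic matrices\<close>

lemma pow_mat_add:
  fixes P :: "'a::semiring_1 mat"
  assumes P: "P \<in> carrier_mat M M"
  shows "P ^\<^sub>m (m + n) = P ^\<^sub>m m * P ^\<^sub>m n"
proof (induction n)
  case (Suc n)
  have "P ^\<^sub>m (m + Suc n) = P ^\<^sub>m m * P ^\<^sub>m n * P" using Suc by simp
  also have "\<dots> = P ^\<^sub>m m * (P ^\<^sub>m n * P)"
    by (rule assoc_mult_mat) (use P in auto)
  finally show ?case by simp
qed (use P in auto)

lemma mult_mat_entry: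
  fixes A B :: "real mat"
  assumes "A \<in> carrier_mat M M" "B \<in> carrier_mat M M" "a < M" "b < M"
  shows "(A * B) $$ (a, b) = (\<Sum>c<M. A $$ (a, c) * B $$ (c, b))"
  using assms by (auto simp: scalar_prod_def atLeast0LessThan)

lemma stochastic_matrix_mult:
  assumes A: "stochastic_matrix M A" and B: "stochastic_matrix M B"
  shows "stochastic_matrix M (A * B)"
proof -
  have c: "A \<in> carrier_mat M M" "B \<in> carrier_mat M M"
    using A B by (auto simp: stochastic_matrix_def)
  note entry = mult_mat_entry[OF c]
  have "(\<Sum>b<M. (A * B) $$ (a, b)) = 1" if "a < M" for a
  proof -
    have "(\<Sum>b<M. (A * B) $$ (a, b)) = (\<Sum>b<M. \<Sum>c<M. A $$ (a, c) * B $$ (c, b))"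
      using that by (simp add: entry)
    also have "\<dots> = (\<Sum>c<M. A $$ (a, c) * (\<Sum>b<M. B $$ (c, b)))"
      by (subst sum.swap) (simp add: sum_distrib_left)
    finally show ?thesis using A B that by (simp add: stochastic_matrix_def)
  qed
  moreover have "0 \<le> (A * B) $$ (a, b)" if "a < M" "b < M" for a b
    using that A B by (auto simp: entry stochastic_matrix_def intro!: sum_nonneg)
  ultimately show ?thesis using c by (auto simp: stochastic_matrix_def)
qed

lemma stochastic_matrix_pow:
  assumes P: "stochastic_matrix M P"
  shows "stochastic_matrix M (P ^\<^sub>m n)"
proof (induction n)
  case 0
  have "(\<Sum>b<M. if a = b then 1 else 0) = (1::real)" if "a < M" for a
    using that by simp
  then show ?case using P by (auto simp: stochastic_matrix_def)
next
  case (Suc n)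
  with P show ?case by (simp add: stochastic_matrix_mult)
qed

lemma mult_mat_pos:
  assumes A: "stochastic_matrix M A" and B: "stochastic_matrix M B"
    and "a < M" "b < M" "c < M" "0 < A $$ (a, b)" "0 < B $$ (b, c)"
  shows "0 < (A * B) $$ (a, c)"
proof -
  have "0 < (\<Sum>d<M. A $$ (a, d) * B $$ (d, c))"
    by (rule sum_pos2[of _ b]) (use assms in \<open>auto simp: stochastic_matrix_def\<close>)
  then show ?thesis
    using assms by (subst mult_mat_entry[of _ M]) (auto simp: stochastic_matrix_def)
qed

text \<open>The times of possible return to \<open>a\<close> are closed under addition and have gcd
  1, so all large times are among them. Appending one possible path from \<open>a\<close> to
  \<open>b\<close> covers the entry \<open>(a, b)\<close>, and there are finitely many
  entries.\<close>

lemma eventually_pow_mat_pos: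
  assumes P: "stochastic_matrix M P" "irreducible_matrix M P" "aperiodic_matrix M P"
  shows "\<forall>\<^sub>F n in sequentially. \<forall>a<M. \<forall>b<M. 0 < (P ^\<^sub>m n) $$ (a, b)"
proof -
  have carr: "P \<in> carrier_mat M M" using P by (simp add: stochastic_matrix_def)
  have pos_add: "0 < (P ^\<^sub>m (m + n)) $$ (a, c)"
    if "0 < (P ^\<^sub>m m) $$ (a, b)" "0 < (P ^\<^sub>m n) $$ (b, c)" "a < M" "b < M" "c < M" for m n a b c
    unfolding pow_mat_add[OF carr]
    by (rule mult_mat_pos[where b = b and M = M]) (use that P stochastic_matrix_pow in auto)
  have "\<forall>\<^sub>F n in sequentially. 0 < (P ^\<^sub>m n) $$ (a, b)" if ab: "a < M" "b < M" for a b
  proof -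
    have "\<forall>\<^sub>F n in sequentially. n \<in> {n. 0 < n \<and> 0 < (P ^\<^sub>m n) $$ (a, a)}"
      by (rule eventually_mem_additive_Gcd_1)
        (use pos_add ab P in \<open>auto simp: aperiodic_matrix_def\<close>)
    moreover obtain r where r: "0 < (P ^\<^sub>m r) $$ (a, b)"
      using P ab by (auto simp: irreducible_matrix_def)
    ultimately have "\<forall>\<^sub>F n in sequentially. 0 < (P ^\<^sub>m (n + r)) $$ (a, b)"
      by (elim eventually_mono) (use pos_add ab in auto)
    then show ?thesis by (rule iffD1[OF eventually_sequentially_seg])
  qed
  then have "\<forall>\<^sub>F n in sequentially. \<forall>a\<in>{..<M}. \<forall>b\<in>{..<M}. 0 < (P ^\<^sub>m n) $$ (a, b)"
    by (intro eventually_ball_finite ballI) auto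
  then show ?thesis by (simp add: Ball_def)
qed

text \<open>Doeblin's contraction in the entrywise l1 norm: once \<alpha> is removed from each
  entry, \<open>Q\<close> stays nonnegative and its columns sum to
  \<open>1 - \<alpha> * real M\<close>. Here \<open>D\<close> stands for the deviation of a power of
  \<open>P\<close> from its limit.\<close>

lemma sum_abs_contraction:
  fixes Q D :: "nat \<Rightarrow> nat \<Rightarrow> real"
  assumes Q: "\<And>a c. a < M \<Longrightarrow> c < M \<Longrightarrow> \<alpha> \<le> Q a c"
    and colQ: "\<And>c. c < M \<Longrightarrow> (\<Sum>a<M. Q a c) = 1"
    and colD: "\<And>b. b < M \<Longrightarrow> (\<Sum>c<M. D c b) = 0"
  shows "(\<Sum>a<M. \<Sum>b<M. \<bar>\<Sum>c<M. Q a c * D c b\<bar>) \<le> (1 - \<alpha> * real M) * (\<Sum>c<M. \<Sum>b<M. \<bar>D c b\<bar>)"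
proof -
  have "(\<Sum>a<M. \<Sum>b<M. \<bar>\<Sum>c<M. Q a c * D c b\<bar>) \<le> (\<Sum>a<M. \<Sum>b<M. \<Sum>c<M. (Q a c - \<alpha>) * \<bar>D c b\<bar>)"
  proof (intro sum_mono)
    fix a b assume ab: "a \<in> {..<M}" "b \<in> {..<M}"
    \<comment> \<open>the columns of \<open>D\<close> sum to 0, so a constant may be subtracted from each row of \<open>Q\<close>\<close>
    have "(\<Sum>c<M. Q a c * D c b) = (\<Sum>c<M. (Q a c - \<alpha>) * D c b)"
      using colD ab by (simp add: algebra_simps sum_subtractf flip: sum_distrib_left)
    also have "\<bar>\<dots>\<bar> \<le> (\<Sum>c<M. \<bar>(Q a c - \<alpha>) * D c b\<bar>)" by (rule sum_abs)
    also have "\<dots> = (\<Sum>c<M. (Q a c - \<alpha>) * \<bar>D c b\<bar>)"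
      using Q ab by (intro sum.cong) (auto simp: abs_mult)
    finally show "\<bar>\<Sum>c<M. Q a c * D c b\<bar> \<le> (\<Sum>c<M. (Q a c - \<alpha>) * \<bar>D c b\<bar>)" .
  qed
  also have "\<dots> = (\<Sum>b<M. \<Sum>c<M. (\<Sum>a<M. Q a c - \<alpha>) * \<bar>D c b\<bar>)"
    unfolding sum_distrib_right by (subst sum.swap, rule sum.cong[OF refl], rule sum.swap)
  also have "\<dots> = (\<Sum>b<M. \<Sum>c<M. (1 - \<alpha> * real M) * \<bar>D c b\<bar>)"
    using colQ by (intro sum.cong) (auto simp: sum_subtractf)
  also have "\<dots> = (1 - \<alpha> * real M) * (\<Sum>c<M. \<Sum>b<M. \<bar>D c b\<bar>)"
    by (subst sum.swap) (simp add: sum_distrib_left)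
  finally show ?thesis .
qed

text \<open>Some power \<open>P ^\<^sub>m N\<close> has all entries bounded below by \<alpha> > 0,
  so every \<open>N\<close> steps shrink the deviation from the constant matrix with entries
  \<open>1 / real M\<close> by a fixed factor.\<close>

lemma pow_mat_mixing:
  assumes P: "stochastic_matrix M P" "irreducible_matrix M P" "aperiodic_matrix M P"
    and stat: "stationary_distribution M P (\<lambda>_. 1 / real M)"
  obtains C \<rho> where "0 \<le> C" "0 < \<rho>" "\<rho> < 1"
    "\<And>m a b. a < M \<Longrightarrow> b < M \<Longrightarrow> \<bar>(P ^\<^sub>m m) $$ (a, b) - 1 / real M\<bar> \<le> C * \<rho> ^ m"
proof -
  have carr: "P \<in> carrier_mat M M" using P by (simp add: stochastic_matrix_def)
  have M: "0 < M" using stat by (cases M) (auto simp: stationary_distribution_def)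
  \<comment> \<open>Stationarity of the uniform distribution says that \<open>P\<close> is doubly
    stochastic; its powers inherit this.\<close>
  have col: "(\<Sum>a<M. (P ^\<^sub>m m) $$ (a, b)) = 1" if "b < M" for m b
    using that
  proof (induction m arbitrary: b)
    case 0
    then show ?case using carr by (simp add: sum.delta)
  next
    case (Suc m)
    have colP: "(\<Sum>a<M. P $$ (a, b)) = 1" if "b < M" for b
    proof -
      have "(\<Sum>a<M. P $$ (a, b)) / real M = 1 / real M"
        using stat that by (simp add: stationary_distribution_def sum_divide_distrib)
      with M show ?thesis by simp
    qed
    have "(\<Sum>a<M. (P ^\<^sub>m Suc m) $$ (a, b)) = (\<Sum>a<M. \<Sum>c<M. (P ^\<^sub>m m) $$ (a, c) * P $$ (c, b))"
      using carr Suc.prems by (simp add: mult_mat_entry[where M = M] del: index_mult_mat)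
    also have "\<dots> = (\<Sum>c<M. (\<Sum>a<M. (P ^\<^sub>m m) $$ (a, c)) * P $$ (c, b))"
      by (subst sum.swap) (simp add: sum_distrib_right)
    finally show ?case using Suc colP by simp
  qed
  define D where "D m a b = (P ^\<^sub>m m) $$ (a, b) - 1 / real M" for m a b
  have colD: "(\<Sum>a<M. D m a b) = 0" if "b < M" for m b
    using col[OF that, of m] M by (simp add: D_def sum_subtractf)
  \<comment> \<open>Rows of a power sum to 1, so multiplication from the left fixes the constant
    matrix and acts on the deviation alone.\<close>
  have rec: "D (n + m) a b = (\<Sum>c<M. (P ^\<^sub>m n) $$ (a, c) * D m c b)" if "a < M" "b < M" for n m a b
  proof -
    have "(P ^\<^sub>m (n + m)) $$ (a, b) = (\<Sum>c<M. (P ^\<^sub>m n) $$ (a, c) * (P ^\<^sub>m m) $$ (c, b))"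
      unfolding pow_mat_add[OF carr] by (rule mult_mat_entry) (use that carr in auto)
    moreover have "(\<Sum>c<M. (P ^\<^sub>m n) $$ (a, c)) = 1"
      using stochastic_matrix_pow[OF P(1), of n] that by (simp add: stochastic_matrix_def)
    ultimately show ?thesis
      by (simp add: D_def right_diff_distrib sum_subtractf flip: sum_divide_distrib)
  qed
  define v where "v m = (\<Sum>a<M. \<Sum>b<M. \<bar>D m a b\<bar>)" for m
  have v_contr: "v (n + m) \<le> (1 - \<alpha> * real M) * v m"
    if "\<And>a c. a < M \<Longrightarrow> c < M \<Longrightarrow> \<alpha> \<le> (P ^\<^sub>m n) $$ (a, c)" for n m \<alpha>
    unfolding v_def using sum_abs_contraction[where Q = "\<lambda>a c. (P ^\<^sub>m n) $$ (a, c)" and D = "D m", OF that col colD]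
    by (simp add: rec)
  have nonneg: "0 \<le> (P ^\<^sub>m n) $$ (a, c)" if "a < M" "c < M" for n a c
    using stochastic_matrix_pow[OF P(1), of n] that by (simp add: stochastic_matrix_def)
  obtain N0 where N0: "\<And>n a b. n \<ge> N0 \<Longrightarrow> a < M \<Longrightarrow> b < M \<Longrightarrow> 0 < (P ^\<^sub>m n) $$ (a, b)"
    using eventually_pow_mat_pos[OF P] unfolding eventually_sequentially by blast
  \<comment> \<open>The successor makes \<open>N\<close> positive, as the root of order
    \<open>N\<close> requires.\<close>
  define N where "N = Suc N0"
  define \<alpha> where "\<alpha> = Min ((\<lambda>(a, b). (P ^\<^sub>m N) $$ (a, b)) ` ({..<M} \<times> {..<M}))"
  have \<alpha>: "0 < \<alpha>" "\<And>a b. a < M \<Longrightarrow> b < M \<Longrightarrow> \<alpha> \<le> (P ^\<^sub>m N) $$ (a, b)"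
  proof -
    show "0 < \<alpha>"
      unfolding \<alpha>_def by (subst Min_gr_iff) (use N0 M in \<open>auto simp: N_def simp del: pow_mat.simps\<close>)
    show "\<alpha> \<le> (P ^\<^sub>m N) $$ (a, b)" if "a < M" "b < M" for a b
      unfolding \<alpha>_def by (rule Min_le) (use that in auto)
  qed
  \<comment> \<open>The maximum keeps \<theta> positive: \<open>1 - \<alpha> * real M\<close>
    vanishes when all entries of the power equal \<open>1 / real M\<close>.\<close>
  define \<theta> where "\<theta> = max (1 - \<alpha> * real M) (1 / 2)"
  have \<theta>: "0 < \<theta>" "\<theta> < 1" using \<alpha> M by (auto simp: \<theta>_def)
  have v0: "0 \<le> v m" for m by (simp add: v_def sum_nonneg)
  have v_bound: "v m \<le> v 0 / \<theta> * root N \<theta> ^ m" for m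
  proof (rule geometric_bound_of_periodic_contraction)
    \<comment> \<open>This is the contraction with lower bound 0 in place of \<alpha>, where
      nonnegativity of the entries suffices.\<close>
    show "v m \<le> v 0" for m
      using v_contr[of 0 m 0] nonneg by simp
    show "v (m + N) \<le> \<theta> * v m" for m
      using v_contr[OF \<alpha>(2), of m] mult_right_mono[OF _ v0, of "1 - \<alpha> * real M" \<theta> m]
      by (auto simp: \<theta>_def add.commute)
  qed (use \<theta> v0 N_def in auto)
  show ?thesis
  proof (rule that[of "v 0 / \<theta>" "root N \<theta>"])
    show "0 < root N \<theta>" "root N \<theta> < 1" "0 \<le> v 0 / \<theta>"
      using \<theta> v0 by (auto simp: N_def)
    fix m a b assume ab: "a < M" "b < M"
    have "\<bar>D m a b\<bar> \<le> (\<Sum>b<M. \<bar>D m a b\<bar>)"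
      using ab by (intro member_le_sum) auto
    also have "\<dots> \<le> v m"
      unfolding v_def using ab by (intro member_le_sum[where f = "\<lambda>a. \<Sum>b<M. \<bar>D m a b\<bar>"]) (auto intro: sum_nonneg)
    also note v_bound[of m]
    finally show "\<bar>(P ^\<^sub>m m) $$ (a, b) - 1 / real M\<bar> \<le> v 0 / \<theta> * root N \<theta> ^ m"
      by (simp add: D_def)
  qed
qed

section \<open>Expectations along the chain\<close>

locale discrete_chain =
  fixes W :: "'w measure" and M :: nat and P :: "real mat" and j :: "nat \<Rightarrow> 'w \<Rightarrow> nat"
  assumes chain: "markov_chain W M P j"
begin

sublocale prob_space W using chain by (simp add: markov_chain_def)

lemma stochastic: "stochastic_matrix M P" using chain by (simp add: markov_chain_def)

lemma carrier_P: "P \<in> carrier_mat M M" using stochastic by (simp add: stochastic_matrix_def)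

lemma measurable_j [measurable]: "j k \<in> measurable W (count_space {..<M})"
  using chain by (simp add: markov_chain_def)

lemma j_less: "\<omega> \<in> space W \<Longrightarrow> j k \<omega> < M"
  using measurable_space[OF measurable_j] by simp

text \<open>Pointwise form of measurability with respect to the first \<open>n + 1\<close> states.
  These take finitely many values, so real functions of this kind are simple and hence integrable.
  \<open>chain_adapted W j Y\<close> states \<open>determined k (Y k)\<close> for every
  \<open>k\<close>.\<close>

definition determined :: "nat \<Rightarrow> ('w \<Rightarrow> 'b) \<Rightarrow> bool" where
  "determined n Y \<longleftrightarrow>
     (\<forall>\<omega>\<in>space W. \<forall>\<omega>'\<in>space W. (\<forall>l\<le>n. j l \<omega> = j l \<omega>') \<longrightarrow> Y \<omega> = Y \<omega>')"

lemma determinedI: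
  assumes "\<And>\<omega> \<omega>'. \<omega> \<in> space W \<Longrightarrow> \<omega>' \<in> space W \<Longrightarrow> (\<And>l. l \<le> n \<Longrightarrow> j l \<omega> = j l \<omega>') \<Longrightarrow> Y \<omega> = Y \<omega>'"
  shows "determined n Y"
  unfolding determined_def by (intro ballI impI assms) blast+

lemma determinedD:
  assumes "determined n Y" "\<omega> \<in> space W" "\<omega>' \<in> space W" "\<And>l. l \<le> n \<Longrightarrow> j l \<omega> = j l \<omega>'"
  shows "Y \<omega> = Y \<omega>'"
  using assms unfolding determined_def by blast

lemma determined_mono:
  assumes "determined m Y" "m \<le> n"
  shows "determined n Y"
proof (rule determinedI)
  fix \<omega> \<omega>' assume "\<omega> \<in> space W" "\<omega>' \<in> space W" "\<And>l. l \<le> n \<Longrightarrow> j l \<omega> = j l \<omega>'"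
  with \<open>m \<le> n\<close> show "Y \<omega> = Y \<omega>'" by (intro determinedD[OF assms(1)]) auto
qed

lemma determined_const: "determined n (\<lambda>_. c)"
  by (rule determinedI) (rule refl)

lemma determined_j: "k \<le> n \<Longrightarrow> determined n (\<lambda>\<omega>. h (j k \<omega>))"
  by (rule determinedI) (rule arg_cong[where f = h])

lemma determined_comp: "determined n Y \<Longrightarrow> determined n (\<lambda>\<omega>. h (Y \<omega>))"
  by (rule determinedI, rule arg_cong[where f = h], rule determinedD)

lemma determined_comp2: "determined n Y \<Longrightarrow> determined n Z \<Longrightarrow> determined n (\<lambda>\<omega>. h (Y \<omega>) (Z \<omega>))"
  by (rule determinedI, rule arg_cong2[where f = h]; rule determinedD)

lemma determined_mult:
  fixes Y Z :: "'w \<Rightarrow> real"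
  shows "determined n Y \<Longrightarrow> determined n Z \<Longrightarrow> determined n (\<lambda>\<omega>. Y \<omega> * Z \<omega>)"
  by (rule determined_comp2)

section \<open>Histories and conditioning on them\<close>

definition history :: "nat \<Rightarrow> (nat \<Rightarrow> nat) \<Rightarrow> 'w set" where
  "history n s = {\<omega> \<in> space W. \<forall>l\<le>n. j l \<omega> = s l}"

abbreviation paths :: "nat \<Rightarrow> (nat \<Rightarrow> nat) set" where
  "paths n \<equiv> PiE {..n} (\<lambda>_. {..<M})"

lemma finite_paths: "finite (paths n)"
  by (intro finite_PiE) auto

lemma sets_history [measurable]: "history n s \<in> sets W"
proof -
  have "history n s = {\<omega> \<in> space W. \<forall>l\<in>{..n}. j l \<omega> = s l}" by (auto simp: history_def)
  also have "\<dots> \<in> sets W" by measurable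
  finally show ?thesis .
qed

text \<open>Exactly one history contains a given outcome, and \<open>Y\<close> is constant on it, so
  its value there can be read off at any chosen point. For an empty history the choice is arbitrary,
  but the indicator vanishes.\<close>

lemma determined_expand:
  fixes Y :: "'w \<Rightarrow> real"
  assumes Y: "determined n Y" and \<omega>: "\<omega> \<in> space W"
  shows "Y \<omega> = (\<Sum>s\<in>paths n. Y (SOME \<omega>. \<omega> \<in> history n s) * indicator (history n s) \<omega>)"
proof -
  define t where "t = restrict (\<lambda>l. j l \<omega>) {..n}"
  have t: "t \<in> paths n" using j_less \<omega> by (auto simp: t_def)
  have mem: "\<omega> \<in> history n t" using \<omega> by (auto simp: history_def t_def)
  then have "(SOME \<omega>. \<omega> \<in> history n t) \<in> history n t" by (rule someI)
  then have eq: "Y (SOME \<omega>. \<omega> \<in> history n t) = Y \<omega>"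
    using \<omega> mem by (intro determinedD[OF Y]) (auto simp: history_def)
  have uniq: "s = t" if "s \<in> paths n" "\<omega> \<in> history n s" for s
    using that t by (intro PiE_ext[OF that(1) t]) (auto simp: t_def history_def)
  have "(\<Sum>s\<in>paths n. Y (SOME \<omega>. \<omega> \<in> history n s) * indicator (history n s) \<omega>)
      = (\<Sum>s\<in>{t}. Y (SOME \<omega>. \<omega> \<in> history n s) * indicator (history n s) \<omega>)"
    using t uniq finite_paths by (intro sum.mono_neutral_right) (auto split: split_indicator)
  then show ?thesis using eq mem by simp
qed

lemma integrable_determined:
  fixes Y :: "'w \<Rightarrow> real"
  assumes Y: "determined n Y"
  shows "integrable W Y"
proof -
  have "integrable W (\<lambda>\<omega>. \<Sum>s\<in>paths n. Y (SOME \<omega>. \<omega> \<in> history n s) * indicator (history n s) \<omega>)"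
    by (intro Bochner_Integration.integrable_sum integrable_mult_right integrable_real_indicator) (auto simp: emeasure_eq_measure)
  then show ?thesis
    by (subst Bochner_Integration.integrable_cong[OF refl determined_expand[OF Y]])
qed

text \<open>Reduces identities about an arbitrary factor known at time \<open>n\<close> to the case
  where the factor is the indicator of a single history.\<close>

lemma expectation_determined_split:
  fixes Y Z :: "'w \<Rightarrow> real"
  assumes Y: "determined n Y" and Z: "determined m Z"
  shows "expectation (\<lambda>\<omega>. Y \<omega> * Z \<omega>)
    = (\<Sum>s\<in>paths n. Y (SOME \<omega>. \<omega> \<in> history n s) * expectation (\<lambda>\<omega>. indicator (history n s) \<omega> * Z \<omega>))"
proof -
  have int: "integrable W (\<lambda>\<omega>. indicator (history n s) \<omega> * Z \<omega>)" for s
    using integrable_mult_indicator[OF sets_history integrable_determined[OF Z], of n s] by simp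
  have "expectation (\<lambda>\<omega>. Y \<omega> * Z \<omega>) = expectation (\<lambda>\<omega>. \<Sum>s\<in>paths n.
      Y (SOME \<omega>. \<omega> \<in> history n s) * (indicator (history n s) \<omega> * Z \<omega>))"
  proof (rule Bochner_Integration.integral_cong[OF refl])
    fix \<omega> assume "\<omega> \<in> space W"
    then show "Y \<omega> * Z \<omega> = (\<Sum>s\<in>paths n. Y (SOME \<omega>. \<omega> \<in> history n s) * (indicator (history n s) \<omega> * Z \<omega>))"
      unfolding mult.assoc[symmetric] sum_distrib_right[symmetric]
      by (rule arg_cong[OF determined_expand[OF Y]])
  qed
  also have "\<dots> = (\<Sum>s\<in>paths n. Y (SOME \<omega>. \<omega> \<in> history n s) * expectation (\<lambda>\<omega>. indicator (history n s) \<omega> * Z \<omega>))"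
    using int by (subst Bochner_Integration.integral_sum) auto
  finally show ?thesis .
qed

text \<open>The Markov property in product form. Unlike the conditional form it also covers
  histories of probability zero, where both sides vanish.\<close>

lemma history_transition:
  assumes s: "s \<in> paths n" and b: "b < M"
  shows "expectation (\<lambda>\<omega>. indicat_real (history n s) \<omega> * of_bool (j (Suc n) \<omega> = b))
    = expectation (\<lambda>\<omega>. indicat_real (history n s) \<omega> * P $$ (j n \<omega>, b))"
proof -
  have hist: "{\<omega> \<in> space W. \<forall>l\<le>n. j l \<omega> = s l} = history n s" by (simp add: history_def)
  define t where "t = s(Suc n := b)"
  have t: "\<forall>l\<le>Suc n. t l < M" using s b by (auto simp: t_def PiE_iff le_Suc_eq)
  have ts: "(\<forall>l\<le>n. j l \<omega> = t l) \<longleftrightarrow> (\<forall>l\<le>n. j l \<omega> = s l)" for \<omega> by (auto simp: t_def)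
  have t_last: "t (Suc n) = b" and t_prev: "t n = s n" by (simp_all add: t_def)
  have ev: "{\<omega> \<in> space W. j (Suc n) \<omega> = b \<and> (\<forall>l\<le>n. j l \<omega> = s l)} = history (Suc n) t"
    by (auto simp: history_def t_def le_Suc_eq)
  have "prob (history (Suc n) t) = prob (history n s) * P $$ (s n, b)"
  proof (cases "prob (history n s) = 0")
    case True
    have "prob (history (Suc n) t) \<le> prob (history n s)"
      by (intro finite_measure_mono) (auto simp: history_def t_def)
    with True show ?thesis using measure_nonneg[of W "history (Suc n) t"] by simp
  next
    case False
    have "\<P>(\<omega> in W. \<forall>l\<le>n. j l \<omega> = t l) \<noteq> 0" using False by (simp only: ts hist not_False_eq_True)
    then have "\<P>(\<omega> in W. j (Suc n) \<omega> = t (Suc n) \<bar> \<forall>l\<le>n. j l \<omega> = t l) = P $$ (t n, t (Suc n))"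
      using chain t unfolding markov_chain_def by blast
    then have "prob (history (Suc n) t) / prob (history n s) = P $$ (s n, b)"
      unfolding cond_prob_def ts t_last t_prev ev hist .
    with False show ?thesis by (simp add: field_simps)
  qed
  moreover have "expectation (\<lambda>\<omega>. indicat_real (history n s) \<omega> * of_bool (j (Suc n) \<omega> = b))
    = expectation (indicat_real (history (Suc n) t))"
    by (rule Bochner_Integration.integral_cong) (auto simp: history_def t_def le_Suc_eq indicator_def)
  moreover have "expectation (\<lambda>\<omega>. indicat_real (history n s) \<omega> * P $$ (j n \<omega>, b))
    = expectation (\<lambda>\<omega>. indicat_real (history n s) \<omega> * P $$ (s n, b))"
    by (rule Bochner_Integration.integral_cong) (auto simp: history_def indicator_def)
  ultimately show ?thesis
    using sets.sets_into_space[OF sets_history, of n s] sets.sets_into_space[OF sets_history, of "Suc n" t]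
    by (simp add: Int_absorb1)
qed

text \<open>The \<open>m\<close>-step Markov property. The last transition is removed by
  conditioning on the first \<open>n + m + 1\<close> states; splitting by the state \<open>c\<close>
  at time \<open>n + m\<close> then gives access to the induction hypothesis.\<close>

lemma expectation_transition:
  fixes Y :: "'w \<Rightarrow> real"
  assumes Y: "determined n Y" and b: "b < M"
  shows "expectation (\<lambda>\<omega>. Y \<omega> * of_bool (j (n + m) \<omega> = b))
    = expectation (\<lambda>\<omega>. Y \<omega> * (P ^\<^sub>m m) $$ (j n \<omega>, b))"
  using b
proof (induction m arbitrary: b)
  case 0
  show ?case
    using 0 carrier_P j_less by (intro Bochner_Integration.integral_cong) auto
next
  case (Suc m)
  have Y': "determined (n + m) Y" using Y by (rule determined_mono) simp
  have step: "expectation (\<lambda>\<omega>. Y \<omega> * of_bool (j (Suc (n + m)) \<omega> = b))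
      = expectation (\<lambda>\<omega>. Y \<omega> * P $$ (j (n + m) \<omega>, b))"
  proof -
    have "determined (Suc (n + m)) (\<lambda>\<omega>. of_bool (j (Suc (n + m)) \<omega> = b) :: real)"
      "determined (n + m) (\<lambda>\<omega>. P $$ (j (n + m) \<omega>, b))"
      by (rule determined_j, simp)+
    then show ?thesis
      using history_transition Suc.prems by (simp add: expectation_determined_split[OF Y'])
  qed
  have int: "integrable W (\<lambda>\<omega>. Y \<omega> * of_bool (j (n + m) \<omega> = c) * P $$ (c, b))"
    "integrable W (\<lambda>\<omega>. Y \<omega> * (P ^\<^sub>m m) $$ (j n \<omega>, c) * P $$ (c, b))" for c
    by (rule integrable_determined[OF determined_mult[OF determined_mult[OF Y' determined_j] determined_const]], simp)+
  have e1: "expectation (\<lambda>\<omega>. Y \<omega> * P $$ (j (n + m) \<omega>, b))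
      = expectation (\<lambda>\<omega>. \<Sum>c<M. Y \<omega> * of_bool (j (n + m) \<omega> = c) * P $$ (c, b))"
  proof (rule Bochner_Integration.integral_cong[OF refl])
    fix \<omega> assume "\<omega> \<in> space W"
    then have "(\<Sum>c<M. of_bool (j (n + m) \<omega> = c) * P $$ (c, b)) = P $$ (j (n + m) \<omega>, b)"
      using j_less by (subst sum.mono_neutral_right[of _ "{j (n + m) \<omega>}"]) auto
    then show "Y \<omega> * P $$ (j (n + m) \<omega>, b)
        = (\<Sum>c<M. Y \<omega> * of_bool (j (n + m) \<omega> = c) * P $$ (c, b))"
      by (simp add: mult.assoc flip: sum_distrib_left)
  qed
  have e2: "expectation (\<lambda>\<omega>. \<Sum>c<M. Y \<omega> * of_bool (j (n + m) \<omega> = c) * P $$ (c, b))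
      = (\<Sum>c<M. expectation (\<lambda>\<omega>. Y \<omega> * of_bool (j (n + m) \<omega> = c)) * P $$ (c, b))"
    by (subst Bochner_Integration.integral_sum[OF int(1)]) (rule sum.cong[OF refl integral_mult_left_zero])
  have e3: "(\<Sum>c<M. expectation (\<lambda>\<omega>. Y \<omega> * of_bool (j (n + m) \<omega> = c)) * P $$ (c, b))
      = (\<Sum>c<M. expectation (\<lambda>\<omega>. Y \<omega> * (P ^\<^sub>m m) $$ (j n \<omega>, c)) * P $$ (c, b))"
    by (rule sum.cong[OF refl], rule arg_cong[where f = "\<lambda>x. x * _"], rule Suc.IH) simp
  have e4: "(\<Sum>c<M. expectation (\<lambda>\<omega>. Y \<omega> * (P ^\<^sub>m m) $$ (j n \<omega>, c)) * P $$ (c, b))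
      = expectation (\<lambda>\<omega>. \<Sum>c<M. Y \<omega> * (P ^\<^sub>m m) $$ (j n \<omega>, c) * P $$ (c, b))"
    by (subst Bochner_Integration.integral_sum[OF int(2)]) (rule sum.cong[OF refl integral_mult_left_zero[symmetric]])
  have e5: "expectation (\<lambda>\<omega>. \<Sum>c<M. Y \<omega> * (P ^\<^sub>m m) $$ (j n \<omega>, c) * P $$ (c, b))
      = expectation (\<lambda>\<omega>. Y \<omega> * (P ^\<^sub>m Suc m) $$ (j n \<omega>, b))"
  proof (rule Bochner_Integration.integral_cong[OF refl])
    fix \<omega> assume "\<omega> \<in> space W"
    then have "(P ^\<^sub>m Suc m) $$ (j n \<omega>, b) = (\<Sum>c<M. (P ^\<^sub>m m) $$ (j n \<omega>, c) * P $$ (c, b))"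
      using j_less Suc.prems carrier_P by (simp add: mult_mat_entry[where M = M] del: index_mult_mat)
    then show "(\<Sum>c<M. Y \<omega> * (P ^\<^sub>m m) $$ (j n \<omega>, c) * P $$ (c, b)) = Y \<omega> * (P ^\<^sub>m Suc m) $$ (j n \<omega>, b)"
      by (simp add: mult.assoc sum_distrib_left)
  qed
  show ?case unfolding add_Suc_right step e1 e2 e3 e4 e5 ..
qed

text \<open>Given the states up to time \<open>n\<close>, the law of \<open>j (n + m)\<close> is row
  \<open>j n\<close> of \<open>P ^\<^sub>m m\<close>. The difference is therefore a sum over
  \<open>i\<close> of expectations of \<open>Y i\<close> times the deviation of one entry from
  \<open>1 / real M\<close>.\<close>

lemma expectation_mixing:
  fixes Y :: "nat \<Rightarrow> 'w \<Rightarrow> real"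
  assumes Y: "\<And>i. i < M \<Longrightarrow> determined n (Y i)"
    and B: "\<And>i \<omega>. i < M \<Longrightarrow> \<omega> \<in> space W \<Longrightarrow> \<bar>Y i \<omega>\<bar> \<le> B"
    and mix: "\<And>a b. a < M \<Longrightarrow> b < M \<Longrightarrow> \<bar>(P ^\<^sub>m m) $$ (a, b) - 1 / real M\<bar> \<le> c"
  shows "\<bar>expectation (\<lambda>\<omega>. Y (j (n + m) \<omega>) \<omega>) - expectation (\<lambda>\<omega>. (\<Sum>i<M. Y i \<omega>) / real M)\<bar>
    \<le> real M * (c * B)"
proof -
  have int: "integrable W (\<lambda>\<omega>. Y i \<omega> * of_bool (j (n + m) \<omega> = i))"
    "integrable W (\<lambda>\<omega>. Y i \<omega> * (P ^\<^sub>m m) $$ (j n \<omega>, i))"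
    "integrable W (\<lambda>\<omega>. Y i \<omega> / real M)" if "i < M" for i
  proof -
    have Y': "determined (n + m) (Y i)" using Y[OF that] by (rule determined_mono) simp
    show "integrable W (\<lambda>\<omega>. Y i \<omega> * of_bool (j (n + m) \<omega> = i))"
      "integrable W (\<lambda>\<omega>. Y i \<omega> * (P ^\<^sub>m m) $$ (j n \<omega>, i))"
      by (rule integrable_determined[OF determined_mult[OF Y' determined_j]], simp)+
    show "integrable W (\<lambda>\<omega>. Y i \<omega> / real M)"
      by (rule integrable_determined[OF determined_comp[OF Y', where h = "\<lambda>y. y / real M"]])
  qed
  have e1: "expectation (\<lambda>\<omega>. Y (j (n + m) \<omega>) \<omega>) = expectation (\<lambda>\<omega>. \<Sum>i<M. Y i \<omega> * of_bool (j (n + m) \<omega> = i))"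
  proof (rule Bochner_Integration.integral_cong[OF refl])
    fix \<omega> assume "\<omega> \<in> space W"
    then show "Y (j (n + m) \<omega>) \<omega> = (\<Sum>i<M. Y i \<omega> * of_bool (j (n + m) \<omega> = i))"
      using j_less by (subst sum.mono_neutral_right[of _ "{j (n + m) \<omega>}"]) auto
  qed
  have e2: "expectation (\<lambda>\<omega>. \<Sum>i<M. Y i \<omega> * of_bool (j (n + m) \<omega> = i))
      = (\<Sum>i<M. expectation (\<lambda>\<omega>. Y i \<omega> * of_bool (j (n + m) \<omega> = i)))"
    by (rule Bochner_Integration.integral_sum) (use int(1) in simp)
  have e3: "(\<Sum>i<M. expectation (\<lambda>\<omega>. Y i \<omega> * of_bool (j (n + m) \<omega> = i)))
      = (\<Sum>i<M. expectation (\<lambda>\<omega>. Y i \<omega> * (P ^\<^sub>m m) $$ (j n \<omega>, i)))"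
    by (intro sum.cong refl expectation_transition) (use Y in simp_all)
  have e4: "expectation (\<lambda>\<omega>. (\<Sum>i<M. Y i \<omega>) / real M) = (\<Sum>i<M. expectation (\<lambda>\<omega>. Y i \<omega> / real M))"
    unfolding sum_divide_distrib by (rule Bochner_Integration.integral_sum) (use int(3) in simp)
  have e5: "expectation (\<lambda>\<omega>. Y (j (n + m) \<omega>) \<omega>) - expectation (\<lambda>\<omega>. (\<Sum>i<M. Y i \<omega>) / real M)
      = (\<Sum>i<M. expectation (\<lambda>\<omega>. Y i \<omega> * ((P ^\<^sub>m m) $$ (j n \<omega>, i) - 1 / real M)))"
    unfolding e1 e2 e3 e4 sum_subtractf[symmetric]
  proof (rule sum.cong[OF refl])
    fix i assume "i \<in> {..<M}"
    then have i: "i < M" by simp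
    have "expectation (\<lambda>\<omega>. Y i \<omega> * (P ^\<^sub>m m) $$ (j n \<omega>, i) - Y i \<omega> / real M)
        = expectation (\<lambda>\<omega>. Y i \<omega> * (P ^\<^sub>m m) $$ (j n \<omega>, i)) - expectation (\<lambda>\<omega>. Y i \<omega> / real M)"
      by (rule Bochner_Integration.integral_diff[OF int(2,3)[OF i]])
    moreover have "(\<lambda>\<omega>. Y i \<omega> * (P ^\<^sub>m m) $$ (j n \<omega>, i) - Y i \<omega> / real M)
        = (\<lambda>\<omega>. Y i \<omega> * ((P ^\<^sub>m m) $$ (j n \<omega>, i) - 1 / real M))"
      by (rule ext) (simp add: right_diff_distrib)
    ultimately show "expectation (\<lambda>\<omega>. Y i \<omega> * (P ^\<^sub>m m) $$ (j n \<omega>, i)) - expectation (\<lambda>\<omega>. Y i \<omega> / real M)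
        = expectation (\<lambda>\<omega>. Y i \<omega> * ((P ^\<^sub>m m) $$ (j n \<omega>, i) - 1 / real M))"
      by (simp only:)
  qed
  have "\<bar>(\<Sum>i<M. expectation (\<lambda>\<omega>. Y i \<omega> * ((P ^\<^sub>m m) $$ (j n \<omega>, i) - 1 / real M)))\<bar>
      \<le> (\<Sum>i<M. \<bar>expectation (\<lambda>\<omega>. Y i \<omega> * ((P ^\<^sub>m m) $$ (j n \<omega>, i) - 1 / real M))\<bar>)"
    by (rule sum_abs)
  also have "\<dots> \<le> (\<Sum>i<M. c * B)"
  proof (intro sum_mono)
    fix i assume "i \<in> {..<M}"
    then have i: "i < M" by simp
    let ?Z = "\<lambda>\<omega>. Y i \<omega> * ((P ^\<^sub>m m) $$ (j n \<omega>, i) - 1 / real M)"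
    have bound: "\<bar>?Z \<omega>\<bar> \<le> c * B" if "\<omega> \<in> space W" for \<omega>
    proof -
      have "\<bar>Y i \<omega>\<bar> * \<bar>(P ^\<^sub>m m) $$ (j n \<omega>, i) - 1 / real M\<bar> \<le> B * c"
        using B[OF i that] mix[OF j_less[OF that] i] by (intro mult_mono) auto
      then show ?thesis by (simp add: abs_mult mult.commute)
    qed
    have "determined n ?Z"
      by (rule determined_mult[OF Y[OF i] determined_j]) simp
    then have int: "integrable W ?Z" by (rule integrable_determined)
    then have "\<bar>expectation ?Z\<bar> \<le> expectation (\<lambda>\<omega>. \<bar>?Z \<omega>\<bar>)"
      by (intro integral_abs_bound)
    also have "\<dots> \<le> expectation (\<lambda>_. c * B)"
      by (intro integral_mono integrable_abs int bound) simp_all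
    finally show "\<bar>expectation ?Z\<bar> \<le> c * B" unfolding Bochner_Integration.lebesgue_integral_const prob_space by simp
  qed
  finally show ?thesis unfolding e5 by simp
qed

end

section \<open>Convex functions near a compact set\<close>

text \<open>A small closed neighbourhood of \<open>X\<close> is compact and lies in the interior of
  \<open>S\<close>, where a convex function is continuous.\<close>

lemma convex_on_bounded_nbhd:
  fixes X S :: "'a::euclidean_space set"
  assumes f: "convex_on S f" and X: "compact X" "X \<subseteq> interior S"
  obtains \<delta> K where "0 < \<delta>" "0 \<le> K" "\<And>x y. x \<in> X \<Longrightarrow> y \<in> cball x \<delta> \<Longrightarrow> y \<in> S \<and> \<bar>f y\<bar> \<le> K"
proof -
  obtain \<delta> where \<delta>: "0 < \<delta>" "(\<Union>x\<in>X. cball x \<delta>) \<subseteq> interior S"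
    using compact_subset_open_imp_cball_epsilon_subset[OF X(1) open_interior X(2)] by blast
  \<comment> \<open>As the sum of \<open>X\<close> and a closed ball, the neighbourhood is a sum of
    two compact sets.\<close>
  have eq: "(\<Union>x\<in>X. cball x \<delta>) = (\<Union>x\<in>X. \<Union>y\<in>cball 0 \<delta>. {x + y})"
  proof -
    have "y \<in> cball x \<delta> \<longleftrightarrow> (\<exists>z\<in>cball 0 \<delta>. y = x + z)" for x y :: 'a
    proof
      assume "y \<in> cball x \<delta>"
      then show "\<exists>z\<in>cball 0 \<delta>. y = x + z"
        by (intro bexI[of _ "y - x"]) (auto simp: dist_norm norm_minus_commute)
    qed (auto simp: dist_norm)
    then show ?thesis by blast
  qed
  have "compact (\<Union>x\<in>X. cball x \<delta>)"
    unfolding eq by (intro compact_sums' X compact_cball)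
  moreover have "continuous_on (interior S) f"
    using f by (intro convex_on_continuous open_interior convex_on_subset[OF f])
      (auto simp: interior_subset convex_on_def)
  then have "continuous_on (\<Union>x\<in>X. cball x \<delta>) f"
    using \<delta>(2) by (rule continuous_on_subset)
  ultimately have "bounded (f ` (\<Union>x\<in>X. cball x \<delta>))"
    by (intro compact_imp_bounded compact_continuous_image)
  then obtain K where K: "\<And>y. y \<in> (\<Union>x\<in>X. cball x \<delta>) \<Longrightarrow> \<bar>f y\<bar> \<le> K"
    unfolding bounded_iff by (metis image_eqI real_norm_def)
  show ?thesis
  proof (rule that[of \<delta> "max 0 K"])
    fix x y assume "x \<in> X" "y \<in> cball x \<delta>"
    then have "y \<in> (\<Union>x\<in>X. cball x \<delta>)" by blast
    then have "y \<in> interior S" "\<bar>f y\<bar> \<le> K" using K \<delta>(2) by blast+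
    then show "y \<in> S \<and> \<bar>f y\<bar> \<le> max 0 K"
      using interior_subset[of S] by auto
  qed (use \<delta> in auto)
qed

text \<open>The room \<delta> around \<open>X\<close>, where the function is bounded by
  \<open>K\<close>, limits slopes: a function cannot rise by more than \<open>2 * K\<close> over a
  distance \<delta>. Both bounds use the same constant \<open>2 * K / \<delta>\<close>.\<close>

lemma convex_on_subgradient_lipschitz_bound:
  fixes X S :: "'a::euclidean_space set"
  assumes f: "convex_on S f" and X: "compact X" "X \<subseteq> interior S"
  obtains L where "0 \<le> L"
    "\<And>x g. x \<in> X \<Longrightarrow> g \<in> subdifferential S f x \<Longrightarrow> norm g \<le> L"
    "\<And>x y. x \<in> X \<Longrightarrow> y \<in> X \<Longrightarrow> \<bar>f y - f x\<bar> \<le> L * norm (y - x)"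
proof -
  obtain \<delta> K where \<delta>: "0 < \<delta>" "0 \<le> K"
    and K: "\<And>x y. x \<in> X \<Longrightarrow> y \<in> cball x \<delta> \<Longrightarrow> y \<in> S \<and> \<bar>f y\<bar> \<le> K"
    using convex_on_bounded_nbhd[OF f X] by metis
  have sub: "norm g \<le> 2 * K / \<delta>" if x: "x \<in> X" and g: "g \<in> subdifferential S f x" for x g
  proof (cases "g = 0")
    case False
    \<comment> \<open>Moving the distance \<delta> along \<open>g\<close> makes the inner product in
      the subgradient inequality equal to \<open>\<delta> * norm g\<close>.\<close>
    define y where "y = x + (\<delta> / norm g) *\<^sub>R g"
    have y: "y \<in> cball x \<delta>" using False \<delta> by (simp add: y_def dist_norm)
    have "f x + inner g (y - x) \<le> f y"
      using g K[OF x y] by (auto simp: subdifferential_def)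
    moreover have "inner g (y - x) = \<delta> * norm g"
      using False by (simp add: y_def dot_square_norm power2_eq_square)
    moreover have "\<bar>f x\<bar> \<le> K" "\<bar>f y\<bar> \<le> K" using K[OF x] K[OF x y] \<delta> by auto
    ultimately have "\<delta> * norm g \<le> 2 * K" by linarith
    with \<delta> show ?thesis by (simp add: field_simps)
  qed (use \<delta> in simp)
  have lip: "f y - f x \<le> 2 * K / \<delta> * norm (y - x)" if x: "x \<in> X" and y: "y \<in> X" for x y
  proof (cases "y = x")
    case False
    define d where "d = norm (y - x)"
    have d: "0 < d" using False by (simp add: d_def)
    \<comment> \<open>\<open>z\<close> lies at distance \<delta> beyond \<open>y\<close> on the ray
      from \<open>x\<close>; the weight \<open>t\<close> below writes \<open>y\<close> as a convex
      combination of \<open>x\<close> and \<open>z\<close>.\<close>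
    define z where "z = y + (\<delta> / d) *\<^sub>R (y - x)"
    have z: "z \<in> cball y \<delta>" using d \<delta> by (simp add: z_def dist_norm d_def)
    define t where "t = d / (\<delta> + d)"
    have t: "0 \<le> t" "t \<le> 1" "t \<le> d / \<delta>" using d \<delta> by (auto simp: t_def field_simps)
    have "\<delta> + d \<noteq> 0" using d \<delta> by simp
    then have "t * (\<delta> / d) = 1 - t" using d by (simp add: t_def field_simps)
    then have "(1 - t) *\<^sub>R x + t *\<^sub>R z = y"
      by (simp add: z_def scaleR_add_right scaleR_diff_right scaleR_diff_left)
    then have "f y \<le> (1 - t) * f x + t * f z"
      using f K[OF x, of x] K[OF y z] t \<delta> unfolding convex_on_def
      by (metis add.commute centre_in_cball diff_add_cancel diff_ge_0_iff_ge less_imp_le)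
    then have "f y - f x \<le> t * (f z - f x)" by (simp add: algebra_simps)
    also have "\<dots> \<le> t * (2 * K)"
      using K[OF x, of x] K[OF y z] t \<delta> by (intro mult_left_mono) auto
    also have "\<dots> \<le> d / \<delta> * (2 * K)" using t \<delta> by (intro mult_right_mono) auto
    finally show ?thesis by (simp add: d_def mult_ac)
  qed simp
  show ?thesis
  proof (rule that[of "2 * K / \<delta>"])
    show "\<bar>f y - f x\<bar> \<le> 2 * K / \<delta> * norm (y - x)" if "x \<in> X" "y \<in> X" for x y
      using lip[OF that] lip[OF that(2,1)] by (simp add: norm_minus_commute abs_le_iff)
  qed (use sub \<delta> in auto)
qed

lemma convex_on_uniform_subgradient_lipschitz_bound:
  fixes X :: "'a::euclidean_space set" and D :: "nat \<Rightarrow> 'a set"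
  assumes f: "\<And>i. i < M \<Longrightarrow> convex_on (D i) (f i)" and X: "compact X" "\<And>i. i < M \<Longrightarrow> X \<subseteq> interior (D i)"
  obtains L where "0 \<le> L"
    "\<And>i x g. i < M \<Longrightarrow> x \<in> X \<Longrightarrow> g \<in> subdifferential (D i) (f i) x \<Longrightarrow> norm g \<le> L"
    "\<And>i x y. i < M \<Longrightarrow> x \<in> X \<Longrightarrow> y \<in> X \<Longrightarrow> \<bar>f i y - f i x\<bar> \<le> L * norm (y - x)"
proof -
  have "\<exists>L. 0 \<le> L \<and> (\<forall>x g. x \<in> X \<longrightarrow> g \<in> subdifferential (D i) (f i) x \<longrightarrow> norm g \<le> L) \<and>
      (\<forall>x y. x \<in> X \<longrightarrow> y \<in> X \<longrightarrow> \<bar>f i y - f i x\<bar> \<le> L * norm (y - x))" if "i < M" for i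
    using convex_on_subgradient_lipschitz_bound[OF f[OF that] X(1) X(2)[OF that]] by metis
  then obtain L where L: "\<And>i. i < M \<Longrightarrow> 0 \<le> L i"
      "\<And>i x g. i < M \<Longrightarrow> x \<in> X \<Longrightarrow> g \<in> subdifferential (D i) (f i) x \<Longrightarrow> norm g \<le> L i"
      "\<And>i x y. i < M \<Longrightarrow> x \<in> X \<Longrightarrow> y \<in> X \<Longrightarrow> \<bar>f i y - f i x\<bar> \<le> L i * norm (y - x)"
    by metis
  have le: "L i \<le> (\<Sum>i<M. L i)" if "i < M" for i
    using that L(1) by (intro member_le_sum) auto
  show ?thesis
  proof (rule that[of "\<Sum>i<M. L i"])
    show "0 \<le> (\<Sum>i<M. L i)" using L(1) by (intro sum_nonneg) auto
    show "norm g \<le> (\<Sum>i<M. L i)" if "i < M" "x \<in> X" "g \<in> subdifferential (D i) (f i) x" for i x g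
      using L(2)[OF that] le[OF that(1)] by linarith
    show "\<bar>f i y - f i x\<bar> \<le> (\<Sum>i<M. L i) * norm (y - x)" if "i < M" "x \<in> X" "y \<in> X" for i x y
      using L(3)[OF that] mult_right_mono[OF le[OF that(1)] norm_ge_zero] order_trans by blast
  qed
qed

section \<open>The Markov chain subgradient method\<close>

text \<open>The setting with all constants fixed: \<open>xs\<close> is a minimiser, \<open>L\<close>
  bounds subgradients and slopes, \<open>R\<close> bounds distances in \<open>X\<close>, and
  \<open>C\<close>, \<rho> describe the mixing. The noise condition appears as summability of
  \<open>\<gamma> k * \<epsilon> k\<close>.\<close>

locale markov_subgradient = discrete_chain W M P j
  for W :: "'w measure" and M :: nat and P :: "real mat" and j :: "nat \<Rightarrow> 'w \<Rightarrow> nat" +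
  fixes X :: "'a::euclidean_space set" and D :: "nat \<Rightarrow> 'a set" and f :: "nat \<Rightarrow> 'a \<Rightarrow> real"
    and \<gamma> \<epsilon> :: "nat \<Rightarrow> real" and e g x :: "nat \<Rightarrow> 'w \<Rightarrow> 'a" and x0 xs :: 'a and L R C \<rho> :: real
  assumes X: "convex X" "compact X" and xs: "xs \<in> X" "\<And>y. y \<in> X \<Longrightarrow> mean_fun M f xs \<le> mean_fun M f y"
    and M: "0 < M"
    and f: "\<And>i. i < M \<Longrightarrow> convex_on X (f i)" and dom: "\<And>i. i < M \<Longrightarrow> X \<subseteq> D i"
    and L: "0 \<le> L" and subgrad_le: "\<And>i y h. i < M \<Longrightarrow> y \<in> X \<Longrightarrow> h \<in> subdifferential (D i) (f i) y \<Longrightarrow> norm h \<le> L"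
    and lip: "\<And>i y z. i < M \<Longrightarrow> y \<in> X \<Longrightarrow> z \<in> X \<Longrightarrow> \<bar>f i z - f i y\<bar> \<le> L * norm (z - y)"
    and diam: "\<And>y z. y \<in> X \<Longrightarrow> z \<in> X \<Longrightarrow> norm (y - z) \<le> R"
    and mix: "0 \<le> C" "0 < \<rho>" "\<rho> < 1"
      "\<And>m a b. a < M \<Longrightarrow> b < M \<Longrightarrow> \<bar>(P ^\<^sub>m m) $$ (a, b) - 1 / real M\<bar> \<le> C * \<rho> ^ m"
    and \<gamma>: "\<And>k. 0 < \<gamma> k" "\<not> summable \<gamma>" "summable (\<lambda>k. (\<gamma> k)\<^sup>2)"
    and noise_summable: "summable (\<lambda>k. \<gamma> k * \<epsilon> k)"
    and e: "chain_adapted W j e" "\<And>k \<omega>. \<omega> \<in> space W \<Longrightarrow> norm (e k \<omega>) \<le> \<epsilon> k"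
    and g: "chain_adapted W j g"
      "\<And>k \<omega>. \<omega> \<in> space W \<Longrightarrow> g k \<omega> \<in> subdifferential (D (j k \<omega>)) (f (j k \<omega>)) (x k \<omega>)"
    and x_0: "\<And>\<omega>. \<omega> \<in> space W \<Longrightarrow> x 0 \<omega> = x0"
    and x_Suc: "\<And>k \<omega>. \<omega> \<in> space W \<Longrightarrow> x (Suc k) \<omega> = closest_point X (x k \<omega> - \<gamma> k *\<^sub>R (g k \<omega> + e k \<omega>))"
begin

abbreviation "F \<equiv> mean_fun M f"

section \<open>Iterates as functions of the chain\<close>

lemma X_closed: "closed X" "X \<noteq> {}" using X xs by (auto intro: compact_imp_closed)

lemma R_nonneg: "0 \<le> R" using diam[OF xs(1) xs(1)] by simp

lemma \<epsilon>_nonneg: "0 \<le> \<epsilon> k"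
proof -
  obtain \<omega> where "\<omega> \<in> space W" using not_empty by blast
  from e(2)[OF this, of k] show ?thesis using norm_ge_zero order_trans by blast
qed

text \<open>The initial point need not lie in \<open>X\<close>, so all estimates start at \<open>x 1\<close>.\<close>

lemma x_in_X: "\<omega> \<in> space W \<Longrightarrow> x (Suc k) \<omega> \<in> X"
  using closest_point_in_set[OF X_closed] by (simp add: x_Suc)

lemma determined_x: "determined k (x (Suc k))"
proof (induction k)
  case 0
  show ?case
  proof (rule determinedI)
    fix \<omega> \<omega>' assume w: "\<omega> \<in> space W" "\<omega>' \<in> space W" "\<And>l. l \<le> 0 \<Longrightarrow> j l \<omega> = j l \<omega>'"
    have "g 0 \<omega> = g 0 \<omega>'" "e 0 \<omega> = e 0 \<omega>'"
      using e(1) g(1) w unfolding chain_adapted_def by blast+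
    then show "x (Suc 0) \<omega> = x (Suc 0) \<omega>'" using w by (simp only: x_Suc x_0)
  qed
next
  case (Suc k)
  show ?case
  proof (rule determinedI)
    fix \<omega> \<omega>' assume w: "\<omega> \<in> space W" "\<omega>' \<in> space W" "\<And>l. l \<le> Suc k \<Longrightarrow> j l \<omega> = j l \<omega>'"
    have "g (Suc k) \<omega> = g (Suc k) \<omega>'" "e (Suc k) \<omega> = e (Suc k) \<omega>'"
      using e(1) g(1) w unfolding chain_adapted_def by blast+
    moreover have "x (Suc k) \<omega> = x (Suc k) \<omega>'"
      by (rule determinedD[OF Suc]) (use w in auto)
    ultimately show "x (Suc (Suc k)) \<omega> = x (Suc (Suc k)) \<omega>'" using w by (simp only: x_Suc)
  qed
qed

lemma determined_fun_x: "k \<le> n \<Longrightarrow> determined n (\<lambda>\<omega>. h (x (Suc k) \<omega>))"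
  by (rule determined_comp[OF determined_mono[OF determined_x]])

lemma integrable_fun_x: "integrable W (\<lambda>\<omega>. h (x (Suc k) \<omega>) :: real)"
  by (rule integrable_determined[OF determined_fun_x]) (rule order_refl)

lemma determined_fun_j_x: "k \<le> n \<Longrightarrow> l \<le> n \<Longrightarrow> determined n (\<lambda>\<omega>. h (j l \<omega>) (x (Suc k) \<omega>))"
  by (rule determined_comp2[OF determined_j[where h = "\<lambda>x. x"] determined_fun_x[where h = "\<lambda>x. x"]])

lemma integrable_fun_j_x: "integrable W (\<lambda>\<omega>. h (j l \<omega>) (x (Suc k) \<omega>) :: real)"
  by (rule integrable_determined[OF determined_fun_j_x[of k "max k l"]]) auto

text \<open>Bounds the step from \<open>x (Suc k)\<close> to \<open>x (Suc (Suc k))\<close>; the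
  index is shifted because the bound \<open>L\<close> on subgradients is available only at points of
  \<open>X\<close>.\<close>

definition step_bound :: "nat \<Rightarrow> real" where "step_bound k = \<gamma> (Suc k) * (L + \<epsilon> (Suc k))"

lemma step_bound_nonneg: "0 \<le> step_bound k"
  using \<gamma>(1)[of "Suc k"] L \<epsilon>_nonneg by (simp add: step_bound_def)

section \<open>Single steps and the accumulated bias\<close>

lemma step_norm_le:
  assumes w: "\<omega> \<in> space W"
  shows "norm (\<gamma> (Suc k) *\<^sub>R (g (Suc k) \<omega> + e (Suc k) \<omega>)) \<le> step_bound k"
proof -
  have "norm (g (Suc k) \<omega>) \<le> L"
    using subgrad_le[OF j_less[OF w] x_in_X[OF w] g(2)[OF w]] .
  then have "norm (g (Suc k) \<omega> + e (Suc k) \<omega>) \<le> L + \<epsilon> (Suc k)"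
    using e(2)[OF w, of "Suc k"] norm_triangle_ineq[of "g (Suc k) \<omega>" "e (Suc k) \<omega>"] by linarith
  then show ?thesis using \<gamma>(1)[of "Suc k"] by (simp add: step_bound_def)
qed

text \<open>The projection is nonexpansive and fixes the current iterate, which lies in
  \<open>X\<close>.\<close>

lemma displacement_le:
  assumes w: "\<omega> \<in> space W"
  shows "norm (x (Suc (Suc k)) \<omega> - x (Suc k) \<omega>) \<le> step_bound k"
proof -
  let ?h = "\<gamma> (Suc k) *\<^sub>R (g (Suc k) \<omega> + e (Suc k) \<omega>)"
  have "dist (closest_point X (x (Suc k) \<omega> - ?h)) (closest_point X (x (Suc k) \<omega>)) \<le> dist (x (Suc k) \<omega> - ?h) (x (Suc k) \<omega>)"
    by (rule closest_point_lipschitz[OF X(1) X_closed])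
  also have "dist (x (Suc k) \<omega> - ?h) (x (Suc k) \<omega>) = norm ?h" by (simp add: dist_norm)
  finally show ?thesis
    using step_norm_le[OF w, of k] by (simp add: x_Suc[OF w, of "Suc k"] closest_point_self[OF x_in_X[OF w]] dist_norm)
qed

text \<open>Projection does not increase the distance to \<open>xs\<close>, and expanding the square
  leaves a subgradient term and a noise term. The former is handled by the subgradient inequality at
  \<open>xs\<close>, the latter by Cauchy-Schwarz and the bound \<open>R\<close>.\<close>

lemma descent:
  assumes w: "\<omega> \<in> space W"
  shows "2 * \<gamma> (Suc k) * (f (j (Suc k) \<omega>) (x (Suc k) \<omega>) - f (j (Suc k) \<omega>) xs)
    \<le> (norm (x (Suc k) \<omega> - xs))\<^sup>2 - (norm (x (Suc (Suc k)) \<omega> - xs))\<^sup>2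
      + (2 * R * (\<gamma> (Suc k) * \<epsilon> (Suc k)) + (step_bound k)\<^sup>2)"
proof -
  let ?y = "x (Suc k) \<omega>" and ?g = "g (Suc k) \<omega>" and ?e = "e (Suc k) \<omega>" and ?\<gamma> = "\<gamma> (Suc k)"
  let ?h = "?\<gamma> *\<^sub>R (?g + ?e)"
  have norm_diff_sq: "(norm (u - h))\<^sup>2 = (norm u)\<^sup>2 - 2 * inner h u + (norm h)\<^sup>2" for u h :: 'a
    by (simp add: power2_norm_eq_inner inner_diff inner_commute)
  have "dist (closest_point X (?y - ?h)) (closest_point X xs) \<le> dist (?y - ?h) xs"
    by (rule closest_point_lipschitz[OF X(1) X_closed])
  then have "norm (x (Suc (Suc k)) \<omega> - xs) \<le> norm ((?y - xs) - ?h)"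
    by (simp add: x_Suc[OF w, of "Suc k"] closest_point_self[OF xs(1)] dist_norm algebra_simps)
  then have "(norm (x (Suc (Suc k)) \<omega> - xs))\<^sup>2 \<le> (norm ((?y - xs) - ?h))\<^sup>2"
    by (rule power_mono) simp
  also have "\<dots> = (norm (?y - xs))\<^sup>2 - 2 * inner ?h (?y - xs) + (norm ?h)\<^sup>2"
    by (rule norm_diff_sq)
  also have "inner ?h (?y - xs) = ?\<gamma> * inner ?g (?y - xs) + ?\<gamma> * inner ?e (?y - xs)"
    by (simp add: inner_add_left algebra_simps)
  finally have le: "(norm (x (Suc (Suc k)) \<omega> - xs))\<^sup>2
      \<le> (norm (?y - xs))\<^sup>2 - 2 * (?\<gamma> * inner ?g (?y - xs) + ?\<gamma> * inner ?e (?y - xs)) + (norm ?h)\<^sup>2" .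
  have "f (j (Suc k) \<omega>) ?y + inner ?g (xs - ?y) \<le> f (j (Suc k) \<omega>) xs"
    using g(2)[OF w, of "Suc k"] dom[OF j_less[OF w]] xs(1) by (auto simp: subdifferential_def)
  then have "?\<gamma> * (f (j (Suc k) \<omega>) ?y - f (j (Suc k) \<omega>) xs) \<le> ?\<gamma> * inner ?g (?y - xs)"
    using \<gamma>(1)[of "Suc k"] by (intro mult_left_mono) (auto simp: inner_diff_right)
  moreover have "- (?\<gamma> * inner ?e (?y - xs)) \<le> R * (?\<gamma> * \<epsilon> (Suc k))"
  proof -
    have "- inner ?e (?y - xs) \<le> norm ?e * norm (?y - xs)"
      using Cauchy_Schwarz_ineq2[of ?e "?y - xs"] by linarith
    also have "\<dots> \<le> \<epsilon> (Suc k) * R"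
      using e(2)[OF w, of "Suc k"] diam[OF x_in_X[OF w] xs(1)] \<epsilon>_nonneg by (intro mult_mono) auto
    finally have "?\<gamma> * (- inner ?e (?y - xs)) \<le> ?\<gamma> * (\<epsilon> (Suc k) * R)"
      using \<gamma>(1)[of "Suc k"] by (intro mult_left_mono) auto
    then show ?thesis by (simp add: mult_ac)
  qed
  moreover have "(norm ?h)\<^sup>2 \<le> (step_bound k)\<^sup>2"
    using step_norm_le[OF w] by (intro power_mono) auto
  ultimately show ?thesis using le by (simp add: algebra_simps)
qed

text \<open>Explicitly, \<open>\<rho> ^ n * L * R\<close> plus the sum over \<open>i < n\<close> of
  \<open>\<rho> ^ (n - i) * L * step_bound i\<close>: a geometric filter of the step
  lengths.\<close>

primrec bias_weight :: "nat \<Rightarrow> real" where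
  "bias_weight 0 = L * R"
| "bias_weight (Suc k) = \<rho> * (bias_weight k + L * step_bound k)"

text \<open>The time \<open>k + 1\<close> is fixed and the iterate varies. The iterate
  \<open>x 1\<close> is known at time 0, so mixing over \<open>k + 1\<close> steps applies. Passing
  to the next iterate changes each component by at most \<open>L * step_bound n\<close>, and this
  change mixes over the remaining \<open>k - n\<close> steps. The case \<open>n = k\<close> bounds
  the bias of the method.\<close>

lemma bias_le:
  assumes "n \<le> k"
  shows "\<bar>expectation (\<lambda>\<omega>. f (j (Suc k) \<omega>) (x (Suc n) \<omega>) - f (j (Suc k) \<omega>) xs)
      - expectation (\<lambda>\<omega>. (\<Sum>i<M. f i (x (Suc n) \<omega>) - f i xs) / real M)\<bar>
    \<le> real M * C * \<rho> ^ (k - n) * bias_weight n"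
  using assms
proof (induction n)
  case 0
  have "\<bar>expectation (\<lambda>\<omega>. f (j (0 + Suc k) \<omega>) (x (Suc 0) \<omega>) - f (j (0 + Suc k) \<omega>) xs)
      - expectation (\<lambda>\<omega>. (\<Sum>i<M. f i (x (Suc 0) \<omega>) - f i xs) / real M)\<bar>
    \<le> real M * (C * \<rho> ^ Suc k * (L * R))"
  proof (rule expectation_mixing)
    show "determined 0 (\<lambda>\<omega>. f i (x (Suc 0) \<omega>) - f i xs)" for i
      by (rule determined_fun_x[where h = "\<lambda>y. f i y - f i xs"]) simp
    show "\<bar>f i (x (Suc 0) \<omega>) - f i xs\<bar> \<le> L * R" if "i < M" "\<omega> \<in> space W" for i \<omega>
      using lip[OF that(1) xs(1) x_in_X[OF that(2)]] mult_left_mono[OF diam[OF x_in_X[OF that(2)] xs(1)] L]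
      by (rule order_trans)
  qed (rule mix(4))
  \<comment> \<open>One factor \<rho> is given up to fit the form with exponent
    \<open>k - 0\<close>.\<close>
  also have "\<dots> \<le> real M * (C * \<rho> ^ k * (L * R))"
    using mix(1-3) L R_nonneg by (intro mult_left_mono mult_right_mono power_decreasing) auto
  finally show ?case by (simp add: mult.assoc)
next
  case (Suc n)
  \<comment> \<open>Both iterates in the increment are known at time \<open>n + 1\<close>, so
    \<open>k - n\<close> steps remain until time \<open>k + 1\<close>.\<close>
  then have nk: "Suc n + (k - n) = Suc k" "k - n = Suc (k - Suc n)" by auto
  define G where "G i y = f i y - f i xs" for i y
  define H where "H i \<omega> = G i (x (Suc (Suc n)) \<omega>) - G i (x (Suc n) \<omega>)" for i \<omega>
  have incr: "\<bar>expectation (\<lambda>\<omega>. H (j (Suc n + (k - n)) \<omega>) \<omega>) - expectation (\<lambda>\<omega>. (\<Sum>i<M. H i \<omega>) / real M)\<bar>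
    \<le> real M * (C * \<rho> ^ (k - n) * (L * step_bound n))"
  proof (rule expectation_mixing)
    show "determined (Suc n) (H i)" for i
      unfolding H_def by (rule determined_comp2[OF determined_fun_x determined_fun_x]) auto
    show "\<bar>H i \<omega>\<bar> \<le> L * step_bound n" if "i < M" "\<omega> \<in> space W" for i \<omega>
      using lip[OF that(1) x_in_X[OF that(2)] x_in_X[OF that(2)], of "Suc n" n]
        mult_left_mono[OF displacement_le[OF that(2), of n] L]
      by (simp add: H_def G_def)
  qed (rule mix(4))
  have IH: "\<bar>expectation (\<lambda>\<omega>. G (j (Suc k) \<omega>) (x (Suc n) \<omega>)) - expectation (\<lambda>\<omega>. (\<Sum>i<M. G i (x (Suc n) \<omega>)) / real M)\<bar>
    \<le> real M * C * \<rho> ^ (k - n) * bias_weight n"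
    using Suc unfolding G_def by simp
  have e1: "expectation (\<lambda>\<omega>. H (j (Suc k) \<omega>) \<omega>)
      = expectation (\<lambda>\<omega>. G (j (Suc k) \<omega>) (x (Suc (Suc n)) \<omega>)) - expectation (\<lambda>\<omega>. G (j (Suc k) \<omega>) (x (Suc n) \<omega>))"
    unfolding H_def by (rule Bochner_Integration.integral_diff; rule integrable_fun_j_x)
  have e2: "expectation (\<lambda>\<omega>. (\<Sum>i<M. H i \<omega>) / real M)
      = expectation (\<lambda>\<omega>. (\<Sum>i<M. G i (x (Suc (Suc n)) \<omega>)) / real M)
        - expectation (\<lambda>\<omega>. (\<Sum>i<M. G i (x (Suc n) \<omega>)) / real M)"
    unfolding H_def sum_subtractf diff_divide_distrib
    by (rule Bochner_Integration.integral_diff; rule integrable_fun_x[where h = "\<lambda>y. (\<Sum>i<M. G i y) / real M"])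
  have "real M * (C * \<rho> ^ (k - n) * (L * step_bound n)) + real M * C * \<rho> ^ (k - n) * bias_weight n
      = real M * C * \<rho> ^ (k - Suc n) * bias_weight (Suc n)"
    using nk(2) by (simp add: algebra_simps)
  then have "\<bar>expectation (\<lambda>\<omega>. G (j (Suc k) \<omega>) (x (Suc (Suc n)) \<omega>))
        - expectation (\<lambda>\<omega>. (\<Sum>i<M. G i (x (Suc (Suc n)) \<omega>)) / real M)\<bar>
      \<le> real M * C * \<rho> ^ (k - Suc n) * bias_weight (Suc n)"
    using incr[unfolded nk(1) e1 e2] IH by linarith
  then show ?case unfolding G_def .
qed

section \<open>Summability and convergence of the expected gaps\<close>

lemma mean_gap: "(\<Sum>i<M. f i y - f i xs) / real M = F y - F xs"
  by (simp add: mean_fun_def sum_subtractf diff_divide_distrib)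

definition expected_gap :: "nat \<Rightarrow> real" where "expected_gap k = expectation (\<lambda>\<omega>. F (x (Suc k) \<omega>) - F xs)"

lemma expected_gap_nonneg: "0 \<le> expected_gap k"
  unfolding expected_gap_def by (rule Bochner_Integration.integral_nonneg) (use xs(2) x_in_X in auto)

lemma summable_noise_Suc: "summable (\<lambda>k. \<gamma> (Suc k) * \<epsilon> (Suc k))"
  using noise_summable by (simp add: summable_Suc_iff[of "\<lambda>k. \<gamma> k * \<epsilon> k"])

text \<open>The noise terms \<open>\<gamma> k * \<epsilon> k\<close> tend to 0, so eventually their
  squares are smaller than the terms themselves; the square of the sum is at most twice the sum of
  squares.\<close>

lemma summable_step_bound_sq: "summable (\<lambda>k. (step_bound k)\<^sup>2)"
proof -
  have nn: "0 \<le> \<gamma> (Suc k) * \<epsilon> (Suc k)" for k using \<gamma>(1)[of "Suc k"] \<epsilon>_nonneg by simp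
  have "\<forall>\<^sub>F k in sequentially. \<gamma> (Suc k) * \<epsilon> (Suc k) < 1"
    using summable_LIMSEQ_zero[OF summable_noise_Suc] by (rule order_tendstoD) simp
  then have "\<forall>\<^sub>F k in sequentially. norm ((\<gamma> (Suc k) * \<epsilon> (Suc k))\<^sup>2) \<le> \<gamma> (Suc k) * \<epsilon> (Suc k)"
    by eventually_elim (use nn in \<open>simp add: power2_eq_square mult_left_le\<close>)
  then have "summable (\<lambda>k. (\<gamma> (Suc k) * \<epsilon> (Suc k))\<^sup>2)"
    using summable_noise_Suc by (rule summable_comparison_test_ev)
  moreover have "summable (\<lambda>k. (\<gamma> (Suc k))\<^sup>2)"
    using \<gamma>(3) by (simp add: summable_Suc_iff[of "\<lambda>k. (\<gamma> k)\<^sup>2"])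
  ultimately have "summable (\<lambda>k. 2 * L\<^sup>2 * (\<gamma> (Suc k))\<^sup>2 + 2 * (\<gamma> (Suc k) * \<epsilon> (Suc k))\<^sup>2)"
    by (intro summable_add summable_mult)
  then show ?thesis
  proof (rule summable_comparison_test')
    fix k
    have "2 * L\<^sup>2 * (\<gamma> (Suc k))\<^sup>2 + 2 * (\<gamma> (Suc k) * \<epsilon> (Suc k))\<^sup>2 - (step_bound k)\<^sup>2 = (L * \<gamma> (Suc k) - \<gamma> (Suc k) * \<epsilon> (Suc k))\<^sup>2"
      by (simp add: step_bound_def power2_eq_square algebra_simps)
    then show "norm ((step_bound k)\<^sup>2) \<le> 2 * L\<^sup>2 * (\<gamma> (Suc k))\<^sup>2 + 2 * (\<gamma> (Suc k) * \<epsilon> (Suc k))\<^sup>2"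
      using zero_le_power2[of "L * \<gamma> (Suc k) - \<gamma> (Suc k) * \<epsilon> (Suc k)"]
      unfolding real_norm_def abs_power2 by linarith
  qed
qed

lemma bias_weight_nonneg: "0 \<le> bias_weight k"
  by (induction k) (use L R_nonneg mix(2) step_bound_nonneg in auto)

text \<open>Half of the expected descent inequality telescopes in the mean squared distance to
  \<open>xs\<close>. Exchanging the sampled component for the mean costs
  \<open>\<gamma> (Suc k)\<close> times the bias, which the geometric filter estimate makes
  summable.\<close>

lemma summable_weighted_gap: "summable (\<lambda>k. \<gamma> (Suc k) * expected_gap k)"
proof (rule summable_telescope_bound)
  let ?V = "\<lambda>k. expectation (\<lambda>\<omega>. (norm (x (Suc k) \<omega> - xs))\<^sup>2)"
  let ?r = "\<lambda>k. 2 * R * (\<gamma> (Suc k) * \<epsilon> (Suc k)) + (step_bound k)\<^sup>2"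
  let ?c = "\<lambda>k. ?r k / 2 + real M * C * (\<gamma> (Suc k) * bias_weight k)"
  show "0 \<le> \<gamma> (Suc k) * expected_gap k" for k using \<gamma>(1)[of "Suc k"] expected_gap_nonneg by simp
  show "0 \<le> ?V k / 2" for k by (simp add: Bochner_Integration.integral_nonneg)
  show "0 \<le> ?c k" for k
    using \<gamma>(1)[of "Suc k"] mix(1) R_nonneg \<epsilon>_nonneg bias_weight_nonneg[of k] by (intro add_nonneg_nonneg) auto
  have "summable (\<lambda>k. (L * step_bound k)\<^sup>2)"
    using summable_mult[OF summable_step_bound_sq, of "L\<^sup>2"] by (simp add: power_mult_distrib)
  moreover have "summable (\<lambda>k. (\<gamma> (Suc k))\<^sup>2)"
    using \<gamma>(3) by (simp add: summable_Suc_iff[of "\<lambda>k. (\<gamma> k)\<^sup>2"])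
  ultimately have "summable (\<lambda>k. \<gamma> (Suc k) * bias_weight k)"
    by (intro summable_mult_geometric_filter[of _ "\<lambda>k. L * step_bound k" \<rho>]) (use mix in auto)
  then show "summable ?c"
    using summable_step_bound_sq summable_noise_Suc by (intro summable_add summable_mult summable_divide)
  fix k
  define A where "A = expectation (\<lambda>\<omega>. f (j (Suc k) \<omega>) (x (Suc k) \<omega>) - f (j (Suc k) \<omega>) xs)"
  have "expectation (\<lambda>\<omega>. 2 * \<gamma> (Suc k) * (f (j (Suc k) \<omega>) (x (Suc k) \<omega>) - f (j (Suc k) \<omega>) xs))
    \<le> expectation (\<lambda>\<omega>. (norm (x (Suc k) \<omega> - xs))\<^sup>2 - (norm (x (Suc (Suc k)) \<omega> - xs))\<^sup>2 + ?r k)"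
  proof (rule integral_mono)
    show "integrable W (\<lambda>\<omega>. 2 * \<gamma> (Suc k) * (f (j (Suc k) \<omega>) (x (Suc k) \<omega>) - f (j (Suc k) \<omega>) xs))"
      by (rule integrable_fun_j_x[where h = "\<lambda>i y. 2 * \<gamma> (Suc k) * (f i y - f i xs)"])
    show "integrable W (\<lambda>\<omega>. (norm (x (Suc k) \<omega> - xs))\<^sup>2 - (norm (x (Suc (Suc k)) \<omega> - xs))\<^sup>2 + ?r k)"
      by (intro Bochner_Integration.integrable_add Bochner_Integration.integrable_diff integrable_const
          integrable_fun_x[where h = "\<lambda>y. (norm (y - xs))\<^sup>2"])
  qed (rule descent)
  also have "\<dots> = ?V k - ?V (Suc k) + ?r k"
  proof -
    have "integrable W (\<lambda>\<omega>. (norm (x (Suc n) \<omega> - xs))\<^sup>2)" for n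
      by (rule integrable_fun_x[where h = "\<lambda>y. (norm (y - xs))\<^sup>2"])
    then show ?thesis by (simp add: prob_space)
  qed
  also have "expectation (\<lambda>\<omega>. 2 * \<gamma> (Suc k) * (f (j (Suc k) \<omega>) (x (Suc k) \<omega>) - f (j (Suc k) \<omega>) xs))
      = 2 * \<gamma> (Suc k) * A"
    unfolding A_def by (rule integral_mult_right_zero)
  finally have "2 * \<gamma> (Suc k) * A / 2 \<le> (?V k - ?V (Suc k) + ?r k) / 2"
    by (rule divide_right_mono) simp
  then have 1: "\<gamma> (Suc k) * A \<le> ?V k / 2 - ?V (Suc k) / 2 + ?r k / 2"
    by (simp add: add_divide_distrib diff_divide_distrib)
  have "\<bar>A - expected_gap k\<bar> \<le> real M * C * bias_weight k"
    using bias_le[of k k] unfolding A_def expected_gap_def mean_gap by simp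
  then have "\<gamma> (Suc k) * (expected_gap k - A) \<le> \<gamma> (Suc k) * (real M * C * bias_weight k)"
    using \<gamma>(1)[of "Suc k"] by (intro mult_left_mono) auto
  with 1 show "\<gamma> (Suc k) * expected_gap k \<le> ?V k / 2 - ?V (Suc k) / 2 + ?c k"
    by (simp add: algebra_simps)
qed

lemma F_lipschitz: "y \<in> X \<Longrightarrow> z \<in> X \<Longrightarrow> \<bar>F z - F y\<bar> \<le> L * norm (z - y)"
proof -
  assume yz: "y \<in> X" "z \<in> X"
  have "\<bar>\<Sum>i<M. f i z - f i y\<bar> \<le> (\<Sum>i<M. L * norm (z - y))"
    by (rule order_trans[OF sum_abs], rule sum_mono, rule lip) (use yz in auto)
  moreover have "F z - F y = (\<Sum>i<M. f i z - f i y) / real M"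
    by (simp add: mean_fun_def sum_subtractf diff_divide_distrib)
  ultimately show ?thesis using M by (simp add: abs_divide pos_divide_le_eq mult_ac)
qed

text \<open>The gaps have a finite weighted sum, and one step raises them by at most
  \<open>L * step_bound k\<close>, which splits into a multiple of the stepsize and a summable noise
  term.\<close>

lemma expected_gap_tendsto_0: "expected_gap \<longlonglongrightarrow> 0"
proof (rule tendsto_0_of_weighted_summable)
  show "0 \<le> expected_gap k" for k by (rule expected_gap_nonneg)
  show "0 \<le> \<gamma> (Suc k)" for k using \<gamma>(1)[of "Suc k"] by simp
  have "(\<lambda>k. sqrt ((\<gamma> k)\<^sup>2)) \<longlonglongrightarrow> sqrt 0"
    by (intro tendsto_real_sqrt summable_LIMSEQ_zero \<gamma>)
  then have "\<gamma> \<longlonglongrightarrow> 0" using \<gamma>(1) by (simp add: less_imp_le)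
  then show "(\<lambda>k. \<gamma> (Suc k)) \<longlonglongrightarrow> 0" by (rule LIMSEQ_Suc)
  show "\<not> summable (\<lambda>k. \<gamma> (Suc k))" using \<gamma>(2) by (simp add: summable_Suc_iff)
  show "summable (\<lambda>k. \<gamma> (Suc k) * expected_gap k)" by (rule summable_weighted_gap)
  show "0 \<le> L * (\<gamma> (Suc k) * \<epsilon> (Suc k))" for k
    using \<gamma>(1)[of "Suc k"] L \<epsilon>_nonneg by simp
  show "summable (\<lambda>k. L * (\<gamma> (Suc k) * \<epsilon> (Suc k)))" by (intro summable_mult summable_noise_Suc)
  show "0 \<le> L * L" by simp
  show "expected_gap (Suc k) \<le> expected_gap k + L * L * \<gamma> (Suc k) + L * (\<gamma> (Suc k) * \<epsilon> (Suc k))" for k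
  proof -
    have int: "integrable W (\<lambda>\<omega>. F (x (Suc n) \<omega>) - F xs)" for n
      by (rule integrable_fun_x[where h = "\<lambda>y. F y - F xs"])
    have "expected_gap (Suc k) \<le> expectation (\<lambda>\<omega>. (F (x (Suc k) \<omega>) - F xs) + L * step_bound k)"
      unfolding expected_gap_def
    proof (rule integral_mono[OF int])
      show "integrable W (\<lambda>\<omega>. (F (x (Suc k) \<omega>) - F xs) + L * step_bound k)"
        by (intro Bochner_Integration.integrable_add int integrable_const)
      fix \<omega> assume w: "\<omega> \<in> space W"
      show "F (x (Suc (Suc k)) \<omega>) - F xs \<le> F (x (Suc k) \<omega>) - F xs + L * step_bound k"
        using F_lipschitz[OF x_in_X[OF w, of k] x_in_X[OF w, of "Suc k"]]
          mult_left_mono[OF displacement_le[OF w, of k] L] by linarith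
    qed
    also have "\<dots> = expected_gap k + L * step_bound k"
      unfolding expected_gap_def by (subst Bochner_Integration.integral_add[OF int integrable_const]) (simp add: prob_space)
    finally show ?thesis by (simp add: step_bound_def algebra_simps)
  qed
qed

lemma expectation_tendsto: "(\<lambda>k. expectation (\<lambda>\<omega>. F (x k \<omega>))) \<longlonglongrightarrow> F xs"
proof -
  have "expectation (\<lambda>\<omega>. F (x (Suc k) \<omega>)) = expected_gap k + F xs" for k
    unfolding expected_gap_def by (subst Bochner_Integration.integral_diff[OF integrable_fun_x integrable_const]) (simp add: prob_space)
  with tendsto_add[OF expected_gap_tendsto_0 tendsto_const[of "F xs"]]
  have "(\<lambda>k. expectation (\<lambda>\<omega>. F (x (Suc k) \<omega>))) \<longlonglongrightarrow> F xs" by simp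
  \<comment> \<open>Undoing the shift brings back \<open>x 0\<close>, which does not affect the
    limit.\<close>
  then show ?thesis by (rule LIMSEQ_imp_Suc)
qed

section \<open>Weighted averages\<close>

lemma F_convex: "convex_on X F"
proof -
  have "convex_on X (\<lambda>y. (1 / real M) * (\<Sum>i<M. f i y))"
  proof (rule convex_on_cmul)
    have "convex_on X (\<lambda>y. \<Sum>i<m. f i y)" if "m \<le> M" for m
      using that
    proof (induction m)
      case 0
      then show ?case using X(1) by (simp add: convex_on_def)
    next
      case (Suc m)
      then show ?case using convex_on_add[of X "\<lambda>y. \<Sum>i<m. f i y" "f m"] f by simp
    qed
    then show "convex_on X (\<lambda>y. \<Sum>i<M. f i y)" by simp
  qed simp
  then show ?thesis by (simp add: mean_fun_def[abs_def])
qed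

text \<open>Jensen's inequality with weights \<open>\<gamma> i\<close> divided by their sum; the
  weighted gaps in the numerator are bounded by their full series. The average stays in
  \<open>X\<close> because it starts with \<open>x 1\<close>.\<close>

lemma weighted_avg_gap:
  assumes k: "1 \<le> k"
  shows "0 \<le> expectation (\<lambda>\<omega>. F (weighted_avg \<gamma> x k \<omega>) - F xs)"
    and "expectation (\<lambda>\<omega>. F (weighted_avg \<gamma> x k \<omega>) - F xs) \<le> (\<Sum>k. \<gamma> (Suc k) * expected_gap k) / (\<Sum>i=1..k. \<gamma> i)"
proof -
  let ?S = "\<Sum>i=1..k. \<gamma> i"
  have S: "0 < ?S" using k \<gamma>(1) by (intro sum_pos) auto
  have avg: "weighted_avg \<gamma> x k \<omega> = (\<Sum>i\<in>{1..k}. (\<gamma> i / ?S) *\<^sub>R x i \<omega>)" for \<omega>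
    by (simp add: weighted_avg_def scaleR_sum_right divide_inverse mult.commute)
  have weights: "(\<Sum>i\<in>{1..k}. \<gamma> i / ?S) = 1" using S by (simp flip: sum_divide_distrib)
  have xi: "x i \<omega> \<in> X" if "i \<in> {1..k}" "\<omega> \<in> space W" for i \<omega>
    using that x_in_X[of \<omega> "i - 1"] by simp
  have avg_in: "weighted_avg \<gamma> x k \<omega> \<in> X" if "\<omega> \<in> space W" for \<omega>
    unfolding avg by (rule convex_sum[OF _ X(1) weights]) (use S \<gamma>(1) xi that in \<open>auto simp: less_imp_le\<close>)
  show "0 \<le> expectation (\<lambda>\<omega>. F (weighted_avg \<gamma> x k \<omega>) - F xs)"
    by (rule Bochner_Integration.integral_nonneg) (use avg_in xs(2) in auto)
  have int: "integrable W (\<lambda>\<omega>. \<gamma> i / ?S * (F (x i \<omega>) - F xs))" if "i \<in> {1..k}" for i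
    using integrable_fun_x[of "\<lambda>y. \<gamma> i / ?S * (F y - F xs)" "i - 1"] that by simp
  have "determined k (\<lambda>\<omega>. F (weighted_avg \<gamma> x k \<omega>) - F xs)"
  proof (rule determinedI)
    fix \<omega> \<omega>' assume w: "\<omega> \<in> space W" "\<omega>' \<in> space W" "\<And>l. l \<le> k \<Longrightarrow> j l \<omega> = j l \<omega>'"
    have "x i \<omega> = x i \<omega>'" if "i \<in> {1..k}" for i
    proof -
      have "x (Suc (i - 1)) \<omega> = x (Suc (i - 1)) \<omega>'"
        by (rule determinedD[OF determined_x w(1,2)], rule w(3)) (use that in auto)
      with that show ?thesis by simp
    qed
    then have "(\<Sum>i=1..k. \<gamma> i *\<^sub>R x i \<omega>) = (\<Sum>i=1..k. \<gamma> i *\<^sub>R x i \<omega>')"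
      by (intro sum.cong) auto
    then show "F (weighted_avg \<gamma> x k \<omega>) - F xs = F (weighted_avg \<gamma> x k \<omega>') - F xs"
      by (simp only: weighted_avg_def)
  qed
  then have int_avg: "integrable W (\<lambda>\<omega>. F (weighted_avg \<gamma> x k \<omega>) - F xs)"
    by (rule integrable_determined)
  have "expectation (\<lambda>\<omega>. F (weighted_avg \<gamma> x k \<omega>) - F xs)
      \<le> expectation (\<lambda>\<omega>. \<Sum>i\<in>{1..k}. \<gamma> i / ?S * (F (x i \<omega>) - F xs))"
  proof (rule integral_mono[OF int_avg Bochner_Integration.integrable_sum[OF int]])
    fix \<omega> assume w: "\<omega> \<in> space W"
    have "F (weighted_avg \<gamma> x k \<omega>) \<le> (\<Sum>i\<in>{1..k}. \<gamma> i / ?S * F (x i \<omega>))"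
      unfolding avg by (rule convex_on_sum[OF _ _ F_convex weights]) (use S \<gamma>(1) xi w k in \<open>auto simp: less_imp_le\<close>)
    then show "F (weighted_avg \<gamma> x k \<omega>) - F xs \<le> (\<Sum>i\<in>{1..k}. \<gamma> i / ?S * (F (x i \<omega>) - F xs))"
      unfolding right_diff_distrib sum_subtractf sum_distrib_right[symmetric] weights by simp
  qed
  also have "\<dots> = (\<Sum>i\<in>{1..k}. expectation (\<lambda>\<omega>. \<gamma> i / ?S * (F (x i \<omega>) - F xs)))"
    by (rule Bochner_Integration.integral_sum[OF int])
  also have "\<dots> = (\<Sum>i\<in>{1..k}. \<gamma> i * expected_gap (i - 1)) / ?S"
    by (simp add: sum_divide_distrib expected_gap_def)
  \<comment> \<open>The gap of \<open>x i\<close> is \<open>expected_gap (i - 1)\<close>, hence the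
    change of index.\<close>
  also have "(\<Sum>i\<in>{1..k}. \<gamma> i * expected_gap (i - 1)) = (\<Sum>i<k. \<gamma> (Suc i) * expected_gap i)"
    by (rule sum.reindex_bij_witness[of _ Suc "\<lambda>i. i - 1"]) auto
  also have "\<dots> / ?S \<le> (\<Sum>k. \<gamma> (Suc k) * expected_gap k) / ?S"
    using S \<gamma>(1) expected_gap_nonneg by (intro divide_right_mono sum_le_suminf summable_weighted_gap) (auto simp: less_imp_le)
  finally show "expectation (\<lambda>\<omega>. F (weighted_avg \<gamma> x k \<omega>) - F xs) \<le> (\<Sum>k. \<gamma> (Suc k) * expected_gap k) / ?S" .
qed

end

text \<open>Compactness, convexity and mixing supply the constants of the locale, and a minimiser
  exists because the mean is Lipschitz on \<open>X\<close>. The constant in the rate is the full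
  series of weighted gaps.\<close>

lemma markov_subgradient_convergence:
  fixes X :: "'a::euclidean_space set" and W :: "'w measure" and \<gamma> \<epsilon> :: "nat \<Rightarrow> real"
  assumes X: "convex X" "compact X" "X \<noteq> {}"
    and f: "\<And>i. i < M \<Longrightarrow> convex_on (D i) (f i)" "\<And>i. i < M \<Longrightarrow> X \<subseteq> interior (D i)"
    and chain: "markov_chain W M P j" "irreducible_matrix M P" "aperiodic_matrix M P"
      "stationary_distribution M P (\<lambda>_. 1 / real M)"
    and \<gamma>: "\<And>k. 0 < \<gamma> k" "\<not> summable \<gamma>" "summable (\<lambda>k. (\<gamma> k)\<^sup>2)" "summable (\<lambda>k. \<gamma> k * \<epsilon> k)"
    and e: "chain_adapted W j e" "\<And>k \<omega>. \<omega> \<in> space W \<Longrightarrow> norm (e k \<omega>) \<le> \<epsilon> k"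
    and iter: "mcgd_iteration W j X D f \<gamma> e x0 x"
  defines "fstar \<equiv> INF y\<in>X. mean_fun M f y"
  shows "(\<lambda>k. \<integral>\<omega>. mean_fun M f (x k \<omega>) \<partial>W) \<longlonglongrightarrow> fstar"
    and "(\<lambda>k. \<integral>\<omega>. (mean_fun M f (weighted_avg \<gamma> x k \<omega>) - fstar) \<partial>W) \<in> O(\<lambda>k. 1 / (\<Sum>i=1..k. \<gamma> i))"
proof -
  have M: "0 < M" using chain(4) by (cases M) (auto simp: stationary_distribution_def)
  have stoch: "stochastic_matrix M P" using chain by (simp add: markov_chain_def)
  obtain C \<rho> where mix: "0 \<le> C" "0 < \<rho>" "\<rho> < 1"
    "\<And>m a b. a < M \<Longrightarrow> b < M \<Longrightarrow> \<bar>(P ^\<^sub>m m) $$ (a, b) - 1 / real M\<bar> \<le> C * \<rho> ^ m"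
    using pow_mat_mixing[OF stoch chain(2-4)] by metis
  obtain L where L: "0 \<le> L"
    "\<And>i x g. i < M \<Longrightarrow> x \<in> X \<Longrightarrow> g \<in> subdifferential (D i) (f i) x \<Longrightarrow> norm g \<le> L"
    "\<And>i x y. i < M \<Longrightarrow> x \<in> X \<Longrightarrow> y \<in> X \<Longrightarrow> \<bar>f i y - f i x\<bar> \<le> L * norm (y - x)"
    using convex_on_uniform_subgradient_lipschitz_bound[of M D f X] f X(2) by metis
  have "continuous_on X (f i)" if "i < M" for i
  proof (rule lipschitz_on_continuous_on)
    show "L-lipschitz_on X (f i)"
      using L(1) L(3)[OF that] by (intro lipschitz_onI) (auto simp: dist_norm)
  qed
  then have "continuous_on X (mean_fun M f)"
    unfolding mean_fun_def[abs_def] using M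
    by (intro continuous_on_divide continuous_on_sum continuous_on_const) auto
  then obtain xs where xs: "xs \<in> X" "\<And>y. y \<in> X \<Longrightarrow> mean_fun M f xs \<le> mean_fun M f y"
    using continuous_attains_inf[OF X(2,3)] by metis
  have fstar: "fstar = mean_fun M f xs"
    unfolding fstar_def by (rule cInf_eq_minimum) (use xs in auto)
  obtain g where g: "chain_adapted W j g"
    and g_x: "\<forall>k. \<forall>\<omega>\<in>space W. g k \<omega> \<in> subdifferential (D (j k \<omega>)) (f (j k \<omega>)) (x k \<omega>) \<and>
      x (Suc k) \<omega> = closest_point X (x k \<omega> - \<gamma> k *\<^sub>R (g k \<omega> + e k \<omega>))"
    and x_0: "\<forall>\<omega>\<in>space W. x 0 \<omega> = x0"
    using iter unfolding mcgd_iteration_def by blast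
  interpret markov_subgradient W M P j X D f \<gamma> \<epsilon> e g x x0 xs L "diameter X" C \<rho>
  proof unfold_locales
    show "convex_on X (f i)" if "i < M" for i
      using f(1)[OF that] f(2)[OF that] interior_subset[of "D i"] X(1) by (blast intro: convex_on_subset)
    show "X \<subseteq> D i" if "i < M" for i using f(2)[OF that] interior_subset[of "D i"] by blast
    show "norm (y - z) \<le> diameter X" if "y \<in> X" "z \<in> X" for y z
      using diameter_bounded_bound[OF compact_imp_bounded[OF X(2)] that] by (simp add: dist_norm)
  qed (fact chain X xs M L mix \<gamma> e g g_x[rule_format, THEN conjunct1] g_x[rule_format, THEN conjunct2] x_0[rule_format])+
  show "(\<lambda>k. \<integral>\<omega>. mean_fun M f (x k \<omega>) \<partial>W) \<longlonglongrightarrow> fstar"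
    unfolding fstar by (rule expectation_tendsto)
  show "(\<lambda>k. \<integral>\<omega>. (mean_fun M f (weighted_avg \<gamma> x k \<omega>) - fstar) \<partial>W) \<in> O(\<lambda>k. 1 / (\<Sum>i=1..k. \<gamma> i))"
  proof (rule bigoI)
    show "\<forall>\<^sub>F k in sequentially. norm (\<integral>\<omega>. (mean_fun M f (weighted_avg \<gamma> x k \<omega>) - fstar) \<partial>W)
        \<le> (\<Sum>k. \<gamma> (Suc k) * expected_gap k) * norm (1 / (\<Sum>i=1..k. \<gamma> i))"
      using eventually_ge_at_top[of 1]
    proof eventually_elim
      case (elim k)
      have "0 \<le> (\<Sum>i=1..k. \<gamma> i)" using \<gamma>(1) by (intro sum_nonneg) (auto intro: less_imp_le)
      then show ?case using weighted_avg_gap[OF elim] unfolding fstar by simp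
    qed
  qed
qed

theorem theorem1:
  fixes X :: "'a::euclidean_space set"
    and D :: "nat \<Rightarrow> 'a set"
    and f :: "nat \<Rightarrow> 'a \<Rightarrow> real"
    and M :: nat
    and P :: "real mat"
    and W :: "'w measure"
    and j :: "nat \<Rightarrow> 'w \<Rightarrow> nat"
    and \<gamma> :: "nat \<Rightarrow> real"
    and x0 :: 'a
  defines "F \<equiv> mean_fun M f"
  defines "fstar \<equiv> (INF y\<in>X. F y)"
  defines "gap \<equiv> (\<lambda>x k. \<integral>\<omega>. (F (weighted_avg \<gamma> x k \<omega>) - fstar) \<partial>W)"
  assumes X: "convex X" "compact X" "X \<noteq> {}"
    and f: "\<And>i. i < M \<Longrightarrow> closed_convex_on (D i) (f i)" "\<And>i. i < M \<Longrightarrow> X \<subseteq> interior (D i)"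
    and chain: "markov_chain W M P j" "irreducible_matrix M P" "aperiodic_matrix M P"
      "stationary_distribution M P (\<lambda>_. 1 / real M)"
    and step: "\<And>k. 0 < \<gamma> k" "\<not> summable \<gamma>" "summable (\<lambda>k. ln (real k) * (\<gamma> k)\<^sup>2)"
  shows
    "(\<forall>x. mcgd_iteration W j X D f \<gamma> (\<lambda>_ _. 0) x0 x \<longrightarrow>
        (\<lambda>k. \<integral>\<omega>. F (x k \<omega>) \<partial>W) \<longlonglongrightarrow> fstar \<and>
        gap x \<in> O(\<lambda>k. mixing_psi P / (\<Sum>i=1..k. \<gamma> i)) \<and>
        (\<forall>q. 1/2 < q \<longrightarrow> q < 1 \<longrightarrow> \<gamma> \<in> \<Theta>(\<lambda>k. 1 / real k powr q) \<longrightarrow>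
           gap x \<in> O(\<lambda>k. mixing_psi P / real k powr (1 - q)))) \<and>
     (\<forall>x e \<epsilon>. chain_adapted W j e \<longrightarrow> (\<forall>k. \<forall>\<omega>\<in>space W. norm (e k \<omega>) \<le> \<epsilon> k) \<longrightarrow>
        mcgd_iteration W j X D f \<gamma> e x0 x \<longrightarrow>
        (summable (\<lambda>k. (\<epsilon> (k + 2))\<^sup>2 / ln (real (k + 2))) \<longrightarrow>
           (\<lambda>k. \<integral>\<omega>. F (x k \<omega>) \<partial>W) \<longlonglongrightarrow> fstar \<and>
           gap x \<in> O(\<lambda>k. mixing_psi P / (\<Sum>i=1..k. \<gamma> i))) \<and>
        (\<forall>p q. 1/2 < p \<longrightarrow> \<epsilon> \<in> O(\<lambda>k. 1 / real k powr p) \<longrightarrow>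
           1/2 < q \<longrightarrow> q < 1 \<longrightarrow> \<gamma> \<in> \<Theta>(\<lambda>k. 1 / real k powr q) \<longrightarrow>
           gap x \<in> O(\<lambda>k. mixing_psi P / real k powr (1 - q))))"
proof -
  let ?S = "\<lambda>k. \<Sum>i=1..k. \<gamma> i"
  have convex: "\<And>i. i < M \<Longrightarrow> convex_on (D i) (f i)" using f(1) by (simp add: closed_convex_on_def)
  \<comment> \<open>The maximum with 1 bounds the factor below, whatever the value of the spectral
    term, so it can be inserted into any \<open>O\<close> bound.\<close>
  have psi: "mixing_psi P \<noteq> 0" unfolding mixing_psi_def by linarith
  have main: "(\<lambda>k. \<integral>\<omega>. F (x k \<omega>) \<partial>W) \<longlonglongrightarrow> fstar" "gap x \<in> O(\<lambda>k. 1 / ?S k)"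
    if "chain_adapted W j e" "\<And>k \<omega>. \<omega> \<in> space W \<Longrightarrow> norm (e k \<omega>) \<le> \<epsilon> k"
      "mcgd_iteration W j X D f \<gamma> e x0 x" "summable (\<lambda>k. (\<epsilon> (k + 2))\<^sup>2 / ln (real (k + 2)))" for x e \<epsilon>
    unfolding gap_def fstar_def F_def
    by (rule markov_subgradient_convergence[OF X convex f(2) chain step(1,2)
        summable_sq_of_ln_weighted[OF step(3)] summable_mult_of_ln_weighted[OF step(3) that(4)] that(1-3)]; assumption)+
  have psi_bigo: "h \<in> O(\<lambda>k. mixing_psi P / u k)" if "h \<in> O(\<lambda>k. 1 / u k)" for h u :: "nat \<Rightarrow> real"
  proof -
    have "O(\<lambda>k. mixing_psi P * (1 / u k)) = O(\<lambda>k. 1 / u k)"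
      by (rule landau_o.big.cmult[OF psi])
    with that show ?thesis by simp
  qed
  have rate: "gap x \<in> O(\<lambda>k. mixing_psi P / real k powr (1 - q))"
    if "gap x \<in> O(\<lambda>k. 1 / ?S k)" "1 / 2 < q" "\<gamma> \<in> \<Theta>(\<lambda>k. 1 / real k powr q)" for x q
  proof -
    \<comment> \<open>The lower half of the \<Theta> condition bounds the stepsize sums from below;
      taking inverses turns this into the rate.\<close>
    have "(\<lambda>k. inverse (?S k)) \<in> O(\<lambda>k. inverse (real k powr (1 - q)))"
    proof (rule landau_o.big.inverse)
      show "(\<lambda>k. real k powr (1 - q)) \<in> O(?S)"
        using that step(1) by (intro powr_bigo_sum) (auto intro: less_imp_le)
      show "\<forall>\<^sub>F k in sequentially. real k powr (1 - q) \<noteq> 0"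
        using eventually_gt_at_top[of 0] by eventually_elim simp
      show "\<forall>\<^sub>F k in sequentially. ?S k \<noteq> 0"
        using eventually_ge_at_top[of 1]
      proof eventually_elim
        case (elim k)
        then have "0 < ?S k" using step(1) by (intro sum_pos) auto
        then show ?case by simp
      qed
    qed
    then have "(\<lambda>k. 1 / ?S k) \<in> O(\<lambda>k. 1 / real k powr (1 - q))"
      by (simp only: inverse_eq_divide)
    with that(1) have "gap x \<in> O(\<lambda>k. 1 / real k powr (1 - q))"
      by (rule landau_o.big_trans)
    then show ?thesis by (rule psi_bigo)
  qed
  \<comment> \<open>The exact iteration is the inexact one with zero noise.\<close>
  have zero: "chain_adapted W j (\<lambda>_ _. 0 :: 'a)" "summable (\<lambda>k. 0\<^sup>2 / ln (real (k + 2)))"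
    by (simp_all add: chain_adapted_def)
  show ?thesis
  proof (intro conjI allI impI)
    fix x assume it: "mcgd_iteration W j X D f \<gamma> (\<lambda>_ _. 0) x0 x"
    note m = main[of "\<lambda>_ _. 0" "\<lambda>_. 0", OF zero(1) _ it zero(2)]
    show "(\<lambda>k. \<integral>\<omega>. F (x k \<omega>) \<partial>W) \<longlonglongrightarrow> fstar" using m(1) by simp
    show "gap x \<in> O(\<lambda>k. mixing_psi P / ?S k)" using psi_bigo[OF m(2)] by simp
    show "gap x \<in> O(\<lambda>k. mixing_psi P / real k powr (1 - q))"
      if "1/2 < q" "\<gamma> \<in> \<Theta>(\<lambda>k. 1 / real k powr q)" for q
      using rate[OF m(2) that] by simp
  next
    fix x e \<epsilon> assume e: "chain_adapted W j e" "\<forall>k. \<forall>\<omega>\<in>space W. norm (e k \<omega>) \<le> \<epsilon> k"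
      and it: "mcgd_iteration W j X D f \<gamma> e x0 x"
    note m = main[of e \<epsilon>, OF e(1) e(2)[rule_format] it]
    show "(\<lambda>k. \<integral>\<omega>. F (x k \<omega>) \<partial>W) \<longlonglongrightarrow> fstar" "gap x \<in> O(\<lambda>k. mixing_psi P / ?S k)"
      if "summable (\<lambda>k. (\<epsilon> (k + 2))\<^sup>2 / ln (real (k + 2)))"
      using m(1)[OF _ that] psi_bigo[OF m(2)[OF _ that]] by simp_all
    show "gap x \<in> O(\<lambda>k. mixing_psi P / real k powr (1 - q))"
      if "1/2 < p" "\<epsilon> \<in> O(\<lambda>k. 1 / real k powr p)" "1/2 < q" "\<gamma> \<in> \<Theta>(\<lambda>k. 1 / real k powr q)" for p q
      using rate[OF m(2)[OF _ summable_sq_div_ln_of_powr[OF that(1,2)]] that(3,4)] by simp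
  qed
qed

end
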